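(* Let $d_1,\dots,d_n\in\mathbb R^3$ be known reference vectors, $\sigma_1,\dots,\sigma_n>0$, and let $R\in SO(3)$ be an unknown parameter observed through the $n$ independent measurements $X_k=R^Td_k+V_k$, $k=1,\dots,n$, where the $V_k$ are independent centered Gaussian vectors in $\mathbb R^3$ with covariance matrices $\sigma_k^2I_3$ (Wahba's problem). Let $H_k=(d_k)_\times$ and $$J(R)=\sum_{k=1}^n\frac1{\sigma_k^2}H_k^TH_k,$$ assumed invertible. Let $\hat R=\hat R(X_1,\dots,X_n)$ be any estimator of $R$ that is unbiased in the sense that $\mathbf E_R\left(\log(R\hat R^T)\right)=0$ for the values of the parameter $R$, and let $P=\mathbf E_R\left(\log(R\hat R^T)\log(R\hat R^T)^T\right)$. Then, up to terms of order $\mathbf E_R\left(\|\log(R\hat R^T)\|^3\right)$, $$P\succeq J(R)^{-1}-\frac1{12}\left(\mathrm{Tr}(P)I_3-P\right)J(R)^{-1}-\frac1{12}J(R)^{-1}\left(\mathrm{Tr}(P)I_3-P\right).$$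
   Context: For $a\in\mathbb R^3$, $(a)_\times\in\mathbb R^{3\times3}$ is the skew-symmetric matrix with $(a)_\times u=a\times u$. The Lie algebra of $SO(3)$ is identified with $\mathbb R^3$; $\exp:\mathbb R^3\to SO(3)$ is $\exp(\xi)=\mathrm{expm}[(\xi)_\times]$ and $\log$ is its inverse, defined around the identity (values in the ball of radius $\pi$). $\mathbf E_R$ is expectation under the law of the measurements when the parameter is $R$. $\succeq$ is the Loewner order. "Up to terms of order $\mathbf E_R(\|\log(R\hat R^T)\|^3)$" means that the inequality holds after adding to its right-hand side some symmetric matrix $E$ with $\|E\|\le c\,\mathbf E_R(\|\log(R\hat R^T)\|^3)$, where $c$ depends only on $J(R)^{-1}$. Regularity convention: $\log(R\hat R^T)$ is defined almost surely, and for every $\xi\in\mathbb R^3$ the unbiasedness identity $\mathbf E_{\exp(t\xi)R}\left(\log(\exp(t\xi)R\hat R^T)\right)=0$ (for $t$ near $0$), written as an integral against the density of the measurements, may be differentiated at $t=0$ under the integral sign. *)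

theory Defs
  imports "HOL-Probability.Probability"
begin

(* Matrix exponential by its power series; the type real^3^3 carries only the componentwise
   product as ( * ), so the library's exp does not apply to it. *)

definition matrix_exp :: "real^'n^'n \<Rightarrow> real^'n^'n" where
  "matrix_exp A = (\<Sum>k. (1 / fact k) *\<^sub>R (((\<lambda>B. A ** B) ^^ k) (mat 1)))"

definition skew3 :: "real^3 \<Rightarrow> real^3^3" where
  "skew3 a = matrix (cross3 a)"

definition so3_exp :: "real^3 \<Rightarrow> real^3^3" where
  "so3_exp \<xi> = matrix_exp (skew3 \<xi>)"

definition so3_log_dom :: "(real^3^3) set" where
  "so3_log_dom = so3_exp ` ball 0 pi"

(* so3_exp is injective on the open ball of radius pi, so this is its inverse on so3_log_dom;
   elsewhere the value is arbitrary. *)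

definition so3_log :: "real^3^3 \<Rightarrow> real^3" where
  "so3_log = inv_into (ball 0 pi) so3_exp"

definition outer :: "real^'n \<Rightarrow> real^'m \<Rightarrow> real^'m^'n" where
  "outer u v = (\<chi> i j. u $ i * v $ j)"

definition loewner_le :: "real^'n^'n \<Rightarrow> real^'n^'n \<Rightarrow> bool" where
  "loewner_le A B \<longleftrightarrow> transpose (B - A) = B - A \<and> (\<forall>v. 0 \<le> v \<bullet> ((B - A) *v v))"

(* Lebesgue density of the Gaussian law on real^3 with mean m and covariance s^2 times the
   identity, i.e. (2 pi s^2) powr (-3/2) * exp (- (norm (v - m))^2 / (2 s^2)). *)

definition gauss3_density :: "real^3 \<Rightarrow> real \<Rightarrow> real^3 \<Rightarrow> real" where
  "gauss3_density m s v = (\<Prod>i\<in>UNIV. normal_density (m $ i) s (v $ i))"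

(* Joint law of the independent noise vectors V k, k < n. *)

definition noise_law :: "nat \<Rightarrow> (nat \<Rightarrow> real) \<Rightarrow> (nat \<Rightarrow> real^3) measure" where
  "noise_law n \<sigma> = (\<Pi>\<^sub>M k\<in>{..<n}. density lborel (\<lambda>v. ennreal (gauss3_density 0 (\<sigma> k) v)))"

(* The noise vectors and the measurements are indexed by k < n. A point of the measurement
   space is a function on {..<n} (undefined elsewhere). *)

definition wahba_law ::
  "nat \<Rightarrow> (nat \<Rightarrow> real^3) \<Rightarrow> (nat \<Rightarrow> real) \<Rightarrow> real^3^3 \<Rightarrow> (nat \<Rightarrow> real^3) measure" where
  "wahba_law n d \<sigma> R =
     distr (noise_law n \<sigma>) (\<Pi>\<^sub>M k\<in>{..<n}. borel)
       (\<lambda>V. \<lambda>k\<in>{..<n}. transpose R *v d k + V k)"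

(* Density of wahba_law with respect to Lebesgue measure, see wahba_law_eq_density. *)

definition wahba_density ::
  "nat \<Rightarrow> (nat \<Rightarrow> real^3) \<Rightarrow> (nat \<Rightarrow> real) \<Rightarrow> real^3^3 \<Rightarrow> (nat \<Rightarrow> real^3) \<Rightarrow> real" where
  "wahba_density n d \<sigma> R X = (\<Prod>k<n. gauss3_density (transpose R *v d k) (\<sigma> k) (X k))"

(* The information matrix does not depend on the rotation. *)

definition wahba_info :: "nat \<Rightarrow> (nat \<Rightarrow> real^3) \<Rightarrow> (nat \<Rightarrow> real) \<Rightarrow> real^3^3" where
  "wahba_info n d \<sigma> =
     (\<Sum>k<n. (1 / (\<sigma> k)\<^sup>2) *\<^sub>R (transpose (skew3 (d k)) ** skew3 (d k)))"

definition SO3_estimator :: "nat \<Rightarrow> ((nat \<Rightarrow> real^3) \<Rightarrow> real^3^3) \<Rightarrow> bool" where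
  "SO3_estimator n Rh \<longleftrightarrow>
     Rh \<in> borel_measurable (\<Pi>\<^sub>M k\<in>{..<n}. borel) \<and>
     (\<forall>X \<in> space (\<Pi>\<^sub>M k\<in>{..<n}. (borel :: (real^3) measure)). rotation_matrix (Rh X))"

definition log_error :: "((nat \<Rightarrow> real^3) \<Rightarrow> real^3^3) \<Rightarrow> real^3^3 \<Rightarrow> (nat \<Rightarrow> real^3) \<Rightarrow> real^3" where
  "log_error Rh R X = so3_log (R ** transpose (Rh X))"

definition unbiased_at ::
  "nat \<Rightarrow> (nat \<Rightarrow> real^3) \<Rightarrow> (nat \<Rightarrow> real) \<Rightarrow> ((nat \<Rightarrow> real^3) \<Rightarrow> real^3^3) \<Rightarrow> real^3^3 \<Rightarrow> bool" where
  "unbiased_at n d \<sigma> Rh R \<longleftrightarrow>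
     (AE X in wahba_law n d \<sigma> R. R ** transpose (Rh X) \<in> so3_log_dom) \<and>
     (\<integral>X. log_error Rh R X \<partial>wahba_law n d \<sigma> R) = 0"

definition error_covariance ::
  "nat \<Rightarrow> (nat \<Rightarrow> real^3) \<Rightarrow> (nat \<Rightarrow> real) \<Rightarrow> ((nat \<Rightarrow> real^3) \<Rightarrow> real^3^3) \<Rightarrow> real^3^3 \<Rightarrow> real^3^3" where
  "error_covariance n d \<sigma> Rh R =
     (\<integral>X. outer (log_error Rh R X) (log_error Rh R X) \<partial>wahba_law n d \<sigma> R)"

definition diff_under_integral_at ::
  "'a measure \<Rightarrow> (real \<Rightarrow> 'a \<Rightarrow> 'b::euclidean_space) \<Rightarrow> real \<Rightarrow> bool" where
  "diff_under_integral_at M f t0 \<longleftrightarrow>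
     (AE x in M. (\<lambda>t. f t x) differentiable at t0) \<and>
     integrable M (\<lambda>x. vector_derivative (\<lambda>t. f t x) (at t0)) \<and>
     ((\<lambda>t. \<integral>x. f t x \<partial>M) has_vector_derivative
        (\<integral>x. vector_derivative (\<lambda>t. f t x) (at t0) \<partial>M)) (at t0)"

definition wahba_regular_at ::
  "nat \<Rightarrow> (nat \<Rightarrow> real^3) \<Rightarrow> (nat \<Rightarrow> real) \<Rightarrow> ((nat \<Rightarrow> real^3) \<Rightarrow> real^3^3) \<Rightarrow> real^3^3 \<Rightarrow> bool" where
  "wahba_regular_at n d \<sigma> Rh R \<longleftrightarrow>
     (\<forall>\<xi>. diff_under_integral_at (\<Pi>\<^sub>M k\<in>{..<n}. lborel)
        (\<lambda>t X. wahba_density n d \<sigma> (so3_exp (t *\<^sub>R \<xi>) ** R) X *\<^sub>R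
               log_error Rh (so3_exp (t *\<^sub>R \<xi>) ** R) X) 0)"

lemma borel_measurable_gauss3_density [measurable]:
  "gauss3_density m s \<in> borel_measurable borel"
  unfolding gauss3_density_def[abs_def] by measurable

lemma gauss3_density_nonneg [simp]: "0 \<le> gauss3_density m s v"
  by (simp add: gauss3_density_def prod_nonneg)

lemma prob_space_gauss3:
  assumes "0 < s"
  shows "prob_space (density lborel (\<lambda>v. ennreal (gauss3_density m s v)))"
proof
  have "(\<integral>\<^sup>+v. ennreal (gauss3_density m s v) \<partial>lborel)
      = (\<integral>\<^sup>+v. (\<Prod>b\<in>Basis. ennreal (normal_density (m \<bullet> b) s (v \<bullet> b))) \<partial>lborel)"
    by (simp add: gauss3_density_def prod_ennreal Basis_vec_def inner_axis inj_def axis_eq_axis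
        UNION_singleton_eq_range prod.reindex)
  also have "\<dots> = (\<Prod>b\<in>Basis. \<integral>\<^sup>+x. ennreal (normal_density (m \<bullet> b) s x) \<partial>lborel)"
    by (rule nn_integral_lborel_prod) auto
  also have "\<dots> = 1"
    by (simp add: nn_integral_eq_integral assms)
  finally show "emeasure (density lborel (\<lambda>v. ennreal (gauss3_density m s v)))
      (space (density lborel (\<lambda>v. ennreal (gauss3_density m s v)))) = 1"
    by (simp add: emeasure_density)
qed

lemma emeasure_gauss3_translate:
  assumes [measurable]: "A \<in> sets borel"
  shows "emeasure (density lborel (\<lambda>v. ennreal (gauss3_density 0 s v))) ((\<lambda>v. m + v) -` A)
       = (\<integral>\<^sup>+x. ennreal (gauss3_density m s x) * indicator A x \<partial>lborel)"
proof -
  have [measurable]: "(\<lambda>v. m + v) -` A \<in> sets borel"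
    using measurable_sets[of "\<lambda>v. m + v" borel borel A] by simp
  have "(\<integral>\<^sup>+x. ennreal (gauss3_density m s x) * indicator A x \<partial>lborel)
      = (\<integral>\<^sup>+x. ennreal (gauss3_density m s x) * indicator A x \<partial>distr lborel borel ((+) m))"
    by (simp only: lborel_distr_plus)
  also have "\<dots> = (\<integral>\<^sup>+v. ennreal (gauss3_density m s (m + v)) * indicator A (m + v) \<partial>lborel)"
    by (subst nn_integral_distr) auto
  also have "\<dots> = (\<integral>\<^sup>+v. ennreal (gauss3_density 0 s v) * indicator ((\<lambda>v. m + v) -` A) v \<partial>lborel)"
    by (intro nn_integral_cong)
       (auto simp: gauss3_density_def normal_density_def indicator_def)
  finally show ?thesis
    by (simp add: emeasure_density)
qed

lemma wahba_law_eq_density: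
  assumes \<sigma>: "\<And>k. k < n \<Longrightarrow> 0 < \<sigma> k"
  shows "wahba_law n d \<sigma> R =
     density (\<Pi>\<^sub>M k\<in>{..<n}. lborel) (\<lambda>X. ennreal (wahba_density n d \<sigma> R X))"
proof -
  define m where "m k = transpose R *v d k" for k
  define s where "s k = (if k < n then \<sigma> k else 1)" for k
  have s: "0 < s k" for k using \<sigma> by (simp add: s_def)
  define N where "N k = density lborel (\<lambda>v. ennreal (gauss3_density 0 (s k) v))" for k
  define G where "G k = density lborel (\<lambda>v. ennreal (gauss3_density (m k) (s k) v))" for k
  interpret N: product_prob_space N "{..<n}"
    by (intro product_prob_spaceI) (simp add: N_def prob_space_gauss3 s)
  interpret G: product_prob_space G "{..<n}"
    by (intro product_prob_spaceI) (simp add: G_def prob_space_gauss3 s)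
  interpret L: product_sigma_finite "\<lambda>_::nat. lborel :: (real^3) measure" ..
  have noise: "noise_law n \<sigma> = Pi\<^sub>M {..<n} N"
    unfolding noise_law_def N_def by (intro PiM_cong) (auto simp: s_def)
  have setsN: "sets (Pi\<^sub>M {..<n} N) = sets (\<Pi>\<^sub>M k\<in>{..<n}. borel)"
    by (intro sets_PiM_cong) (auto simp: N_def)
  have spN: "space (Pi\<^sub>M {..<n} N) = (\<Pi>\<^sub>E k\<in>{..<n}. UNIV)"
    by (auto simp: space_PiM N_def)
  have meas: "(\<lambda>V. \<lambda>k\<in>{..<n}. m k + V k) \<in> measurable (Pi\<^sub>M {..<n} N) (\<Pi>\<^sub>M k\<in>{..<n}. borel)"
    by (subst measurable_cong_sets[OF setsN refl]) measurable
  have dmeas: "(\<lambda>X. wahba_density n d \<sigma> R X) \<in> borel_measurable (\<Pi>\<^sub>M k\<in>{..<n}. lborel)"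
    unfolding wahba_density_def by measurable
  have 1: "wahba_law n d \<sigma> R = Pi\<^sub>M {..<n} G"
  proof (rule G.PiM_eqI)
    show "sets (wahba_law n d \<sigma> R) = sets (Pi\<^sub>M {..<n} G)"
      unfolding wahba_law_def by (simp, intro sets_PiM_cong) (auto simp: G_def)
  next
    fix A assume "\<And>k. k \<in> {..<n} \<Longrightarrow> A k \<in> sets (G k)"
    hence A: "\<And>k. k < n \<Longrightarrow> A k \<in> sets borel" by (simp add: G_def)
    have A': "(\<lambda>v. m k + v) -` A k \<in> sets borel" if "k < n" for k
      using measurable_sets[of "\<lambda>v. m k + v" borel borel "A k"] A[OF that] by simp
    have "emeasure (wahba_law n d \<sigma> R) (Pi\<^sub>E {..<n} A)
        = emeasure (Pi\<^sub>M {..<n} N)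
            ((\<lambda>V. \<lambda>k\<in>{..<n}. m k + V k) -` (Pi\<^sub>E {..<n} A) \<inter> space (Pi\<^sub>M {..<n} N))"
      unfolding wahba_law_def noise m_def[symmetric]
      by (rule emeasure_distr[OF meas]) (auto intro!: sets_PiM_I_finite A)
    also have "(\<lambda>V. \<lambda>k\<in>{..<n}. m k + V k) -` (Pi\<^sub>E {..<n} A) \<inter> space (Pi\<^sub>M {..<n} N)
        = (\<Pi>\<^sub>E k\<in>{..<n}. (\<lambda>v. m k + v) -` A k)"
      by (auto simp: spN PiE_iff)
    also have "emeasure (Pi\<^sub>M {..<n} N) \<dots> = (\<Prod>k<n. emeasure (N k) ((\<lambda>v. m k + v) -` A k))"
      by (rule N.emeasure_PiM) (auto simp: N_def A')
    also have "\<dots> = (\<Prod>k<n. emeasure (G k) (A k))"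
      by (intro prod.cong refl)
         (simp add: N_def G_def emeasure_gauss3_translate A emeasure_density)
    finally show "emeasure (wahba_law n d \<sigma> R) (Pi\<^sub>E {..<n} A) = (\<Prod>k\<in>{..<n}. emeasure (G k) (A k))" .
  qed simp
  have 2: "density (\<Pi>\<^sub>M k\<in>{..<n}. lborel) (\<lambda>X. ennreal (wahba_density n d \<sigma> R X)) = Pi\<^sub>M {..<n} G"
  proof (rule G.PiM_eqI)
    show "sets (density (\<Pi>\<^sub>M k\<in>{..<n}. lborel) (\<lambda>X. ennreal (wahba_density n d \<sigma> R X)))
        = sets (Pi\<^sub>M {..<n} G)"
      by (simp, intro sets_PiM_cong) (auto simp: G_def)
  next
    fix A assume "\<And>k. k \<in> {..<n} \<Longrightarrow> A k \<in> sets (G k)"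
    hence A: "\<And>k. k < n \<Longrightarrow> A k \<in> sets borel" by (simp add: G_def)
    have ind: "indicator (Pi\<^sub>E {..<n} A) X = (\<Prod>k<n. indicator (A k) (X k) :: ennreal)"
      if "X \<in> space (\<Pi>\<^sub>M k\<in>{..<n}. lborel :: (real^3) measure)" for X
      using that by (auto simp: space_PiM PiE_iff indicator_def prod_zero_iff)
    have "emeasure (density (\<Pi>\<^sub>M k\<in>{..<n}. lborel) (\<lambda>X. ennreal (wahba_density n d \<sigma> R X))) (Pi\<^sub>E {..<n} A)
        = (\<integral>\<^sup>+X. ennreal (wahba_density n d \<sigma> R X) * indicator (Pi\<^sub>E {..<n} A) X \<partial>(\<Pi>\<^sub>M k\<in>{..<n}. lborel))"
      using dmeas by (intro emeasure_density) (auto intro!: sets_PiM_I_finite A)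
    also have "\<dots> = (\<integral>\<^sup>+X. (\<Prod>k<n. ennreal (gauss3_density (m k) (\<sigma> k) (X k)) * indicator (A k) (X k))
        \<partial>(\<Pi>\<^sub>M k\<in>{..<n}. lborel))"
      by (intro nn_integral_cong)
         (simp add: ind wahba_density_def m_def prod_ennreal[symmetric] prod.distrib)
    also have "\<dots> = (\<Prod>k<n. \<integral>\<^sup>+x. ennreal (gauss3_density (m k) (\<sigma> k) x) * indicator (A k) x \<partial>lborel)"
      by (rule L.product_nn_integral_prod) (auto intro!: borel_measurable_times_ennreal borel_measurable_indicator A)
    also have "\<dots> = (\<Prod>k<n. emeasure (G k) (A k))"
      by (intro prod.cong refl) (simp add: G_def A emeasure_density s_def)
    finally show "emeasure (density (\<Pi>\<^sub>M k\<in>{..<n}. lborel)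
        (\<lambda>X. ennreal (wahba_density n d \<sigma> R X))) (Pi\<^sub>E {..<n} A) = (\<Prod>k\<in>{..<n}. emeasure (G k) (A k))" .
  qed simp
  show ?thesis using 1 2 by simp
qed

end

theory Submission
  imports Defs
begin

text \<open>Write \<open>e = log (R Rh\<^sup>T)\<close> and let \<open>s\<^sub>w\<close> be the score in direction \<open>w\<close>. Differentiating the unbiasedness
  identity at \<open>t = 0\<close> in direction \<open>w\<close> gives \<open>E (s\<^sub>w e + D(e) w) = 0\<close>, where \<open>D(x) w\<close> is the derivative of
  \<open>log (exp (t w) exp x)\<close>, which equals \<open>w - x \<times> w / 2 + x \<times> (x \<times> w) / 12\<close> up to a term of size
  \<open>\<bar>x\<bar>\<^sup>3 \<bar>w\<bar>\<close> on the whole ball of radius \<open>pi\<close>. Since \<open>E e = 0\<close>, this reads \<open>E (s\<^sub>w e) = - A w\<close> with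
  \<open>A = I - M / 12 + B\<close>, \<open>M = Tr(P) I - P\<close> and \<open>\<bar>B\<bar> = O(E \<bar>e\<bar>\<^sup>3)\<close>. As \<open>E s\<^sub>w\<^sup>2 = w \<bullet> J w\<close>, expanding
  \<open>0 \<le> E (v \<bullet> e + s\<^sub>w)\<^sup>2\<close> with \<open>w = J\<^sup>-\<^sup>1 v\<close> gives
  \<open>v \<bullet> P v \<ge> 2 v \<bullet> A J\<^sup>-\<^sup>1 v - v \<bullet> J\<^sup>-\<^sup>1 v\<close>, in which the error term is linear in \<open>B\<close>.\<close>

subsection \<open>The exponential map of SO(3)\<close>

unbundle cross3_syntax

lemma skew3_mult_vec [simp]: "skew3 a *v u = cross3 a u"
  unfolding skew3_def using bilinear_cross by (simp add: matrix_works bilinear_def)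

lemma skew3_scaleR: "skew3 (t *\<^sub>R a) = t *\<^sub>R skew3 a"
  by (simp add: matrix_eq scaleR_matrix_vector_assoc[symmetric] cross_mult_left)

lemma bounded_linear_skew3: "bounded_linear skew3"
  by (rule linear_conv_bounded_linear[THEN iffD1])
    (auto simp: linear_iff skew3_scaleR matrix_eq matrix_vector_mult_add_rdistrib cross_add_left)

lemma skew3_0 [simp]: "skew3 0 = 0"
  using skew3_scaleR[of 0 0] by simp

lemma bounded_bilinear_matrix_mult:
  "bounded_bilinear ((**) :: real^'n^'m \<Rightarrow> real^'p^'n \<Rightarrow> real^'p^'m)"
  by (rule bilinear_conv_bounded_bilinear[THEN iffD1])
    (auto simp: bilinear_def linear_iff matrix_matrix_mult_def vec_eq_iff sum.distrib
      sum_distrib_left algebra_simps)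

lemmas matrix_mult_scaleR =
  bounded_bilinear.scaleR_left[OF bounded_bilinear_matrix_mult]
  bounded_bilinear.scaleR_right[OF bounded_bilinear_matrix_mult]

lemma transpose_skew3: "transpose (skew3 a) = - skew3 a"
  by (simp add: skew3_def matrix_def transpose_def cross3_simps axis_def forall_3)

text \<open>Since \<open>x \<times> u\<close> is orthogonal to \<open>x\<close>, the Lagrange
  formula for the double cross product leaves only the term in \<open>x \<times> u\<close>. This is
  Cayley-Hamilton for \<open>skew3 x\<close> and makes its powers cycle up to scalars.\<close>

lemma skew3_cube: "skew3 x ** (skew3 x ** skew3 x) = - ((norm x)\<^sup>2) *\<^sub>R skew3 x"
proof -
  have "x \<times> (x \<times> (x \<times> u)) = - ((norm x)\<^sup>2) *\<^sub>R (x \<times> u)" for u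
    by (simp add: Lagrange[of x x "x \<times> u"] dot_cross_self power2_norm_eq_inner)
  then show ?thesis
    by (simp only: matrix_eq matrix_vector_mul_assoc[symmetric] scaleR_matrix_vector_assoc[symmetric]
        skew3_mult_vec simp_thms)
qed

text \<open>Each factor of \<open>A ** A\<close> beyond the first power contributes
  \<open>- \<theta>\<^sup>2\<close> by \<open>skew3_cube\<close>. The even case starts at exponent 2
  because \<open>mat 1\<close> is not a multiple of \<open>A ** A\<close>.\<close>

lemma skew3_power:
  fixes x :: "real^3"
  defines "A \<equiv> skew3 x" and "\<theta> \<equiv> norm x"
  shows "((\<lambda>B. A ** B) ^^ (2*k+1)) (mat 1) = ((-1)^k * \<theta>^(2*k)) *\<^sub>R A"
    and "((\<lambda>B. A ** B) ^^ (2*k+2)) (mat 1) = ((-1)^k * \<theta>^(2*k)) *\<^sub>R (A ** A)"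
proof -
  have *: "A ** (A ** A) = - (\<theta>\<^sup>2) *\<^sub>R A"
    unfolding A_def \<theta>_def by (rule skew3_cube)
  show 1: "((\<lambda>B. A ** B) ^^ (2*k+1)) (mat 1) = ((-1)^k * \<theta>^(2*k)) *\<^sub>R A" for k
  proof (induction k)
    case (Suc k)
    have "2 * Suc k + 1 = Suc (Suc (2*k+1))" by simp
    then show ?case
      by (simp only: funpow.simps o_apply Suc)
         (simp add: matrix_mult_scaleR * mult_ac power2_eq_square)
  qed simp
  have "2 * k + 2 = Suc (2*k+1)" by simp
  then show "((\<lambda>B. A ** B) ^^ (2*k+2)) (mat 1) = ((-1)^k * \<theta>^(2*k)) *\<^sub>R (A ** A)"
    by (simp only: funpow.simps o_apply 1) (simp add: matrix_mult_scaleR)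
qed

text \<open>Splitting the exponential series by parity, the odd powers sum to the sine series and
  the positive even ones to the series of 1 minus cosine. At \<open>x = 0\<close> the quotients take
  the default value 0, which is consistent because \<open>skew3 0 = 0\<close>.\<close>

lemma Rodrigues:
  "so3_exp x = mat 1 + (sin (norm x) / norm x) *\<^sub>R skew3 x
     + ((1 - cos (norm x)) / (norm x)\<^sup>2) *\<^sub>R (skew3 x ** skew3 x)"
proof (cases "x = 0")
  case True
  have *: "(((**) (0::real^3^3)) ^^ k) (mat 1) = (if k = 0 then mat 1 else 0)" for k
    by (cases k) auto
  have "so3_exp x = (\<Sum>k. if k = 0 then (1 / fact 0) *\<^sub>R (mat 1 :: real^3^3) else 0)"
    unfolding so3_exp_def matrix_exp_def True skew3_0 * by (intro suminf_cong) auto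
  also have "\<dots> = mat 1"
    using sums_single[of 0 "\<lambda>k. (1 / fact 0) *\<^sub>R (mat 1 :: real^3^3)"] by (simp add: sums_iff)
  finally show ?thesis by (simp add: True)
next
  case False
  define A where "A = skew3 x"
  define \<theta> where "\<theta> = norm x"
  have \<theta>: "\<theta> \<noteq> 0" using False by (simp add: \<theta>_def)
  \<comment> \<open>One expression covers \<open>k = 0\<close>, odd \<open>k\<close> and positive
    even \<open>k\<close>, so that the series can be summed without regrouping. The conditional in
    the last coefficient cancels the constant term of the cosine series.\<close>
  have tm: "(1 / fact k) *\<^sub>R (((\<lambda>B. A ** B) ^^ k) (mat 1)) =
       (if k = 0 then 1 else 0) *\<^sub>R mat 1 + (sin_coeff k *\<^sub>R \<theta>^k) *\<^sub>R ((1/\<theta>) *\<^sub>R A)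
       + ((if k = 0 then 1 else 0) - cos_coeff k *\<^sub>R \<theta>^k) *\<^sub>R ((1/\<theta>\<^sup>2) *\<^sub>R (A ** A))" (is "?l = ?r k") for k
  proof -
    consider "k = 0" | m where "k = 2*m+1" | m where "k = 2*m+2"
      by (metis One_nat_def Suc_eq_plus1 add_2_eq_Suc' add_Suc_right mult_Suc_right numeral_2_eq_2 oddE evenE not0_implies_Suc add.commute)
    then show ?thesis
    proof cases
      case 2
      have "?l = ((1 / fact k) * ((-1)^m * \<theta>^(2*m))) *\<^sub>R A"
        unfolding 2 A_def \<theta>_def skew3_power by simp
      also have "\<dots> = ?r k"
        using \<theta> by (simp add: 2 sin_coeff_def cos_coeff_def field_simps)
      finally show ?thesis .
    next
      case 3
      have "?l = ((1 / fact k) * ((-1)^m * \<theta>^(2*m))) *\<^sub>R (A ** A)"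
        unfolding 3 A_def \<theta>_def skew3_power by simp
      also have "\<dots> = ?r k"
        using \<theta> by (simp add: 3 sin_coeff_def cos_coeff_def field_simps power2_eq_square)
      finally show ?thesis .
    qed simp
  qed
  have s0: "(\<lambda>k. if k = 0 then 1 else 0 :: real) sums 1"
    using sums_single[of 0 "\<lambda>_. 1::real"] by simp
  have "(\<lambda>k. ?r k) sums (1 *\<^sub>R mat 1 + sin \<theta> *\<^sub>R ((1/\<theta>) *\<^sub>R A) + (1 - cos \<theta>) *\<^sub>R ((1/\<theta>\<^sup>2) *\<^sub>R (A ** A)))"
    by (intro sums_add sums_diff bounded_linear.sums[OF bounded_linear_scaleR_left] s0 sin_converges cos_converges)
  then have "so3_exp x = 1 *\<^sub>R mat 1 + sin \<theta> *\<^sub>R ((1/\<theta>) *\<^sub>R A) + (1 - cos \<theta>) *\<^sub>R ((1/\<theta>\<^sup>2) *\<^sub>R (A ** A))"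
    unfolding so3_exp_def matrix_exp_def A_def[symmetric] tm by (rule sums_unique[symmetric])
  then show ?thesis by (simp add: A_def \<theta>_def)
qed

lemma so3_exp_0 [simp]: "so3_exp 0 = mat 1"
  by (simp add: Rodrigues)

subsection \<open>The logarithm of SO(3)\<close>

text \<open>The vector whose \<open>skew3\<close> is the skew-symmetric part of \<open>Y\<close>.
  Being linear and zero on symmetric matrices, it isolates the sine term of
  \<open>Rodrigues\<close>.\<close>

definition axial :: "real^3^3 \<Rightarrow> real^3" where
  "axial Y = (1/2) *\<^sub>R vector [Y$3$2 - Y$2$3, Y$1$3 - Y$3$1, Y$2$1 - Y$1$2]"

lemma skew3_nth:
  "skew3 x $ 1 $ 1 = 0" "skew3 x $ 1 $ 2 = - x $ 3" "skew3 x $ 1 $ 3 = x $ 2"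
  "skew3 x $ 2 $ 1 = x $ 3" "skew3 x $ 2 $ 2 = 0" "skew3 x $ 2 $ 3 = - x $ 1"
  "skew3 x $ 3 $ 1 = - x $ 2" "skew3 x $ 3 $ 2 = x $ 1" "skew3 x $ 3 $ 3 = 0"
  by (simp_all add: skew3_def matrix_def cross3_def axis_def)

lemma bounded_linear_axial: "bounded_linear axial"
  by (rule linear_conv_bounded_linear[THEN iffD1])
    (auto simp: linear_iff axial_def vec_eq_iff forall_3 algebra_simps add_divide_distrib diff_divide_distrib)

lemma bounded_linear_trace: "bounded_linear (trace :: real^'n^'n \<Rightarrow> real)"
  by (rule linear_conv_bounded_linear[THEN iffD1])
    (auto simp: linear_iff trace_def sum.distrib sum_distrib_left)

lemma axial_mat [simp]: "axial (mat 1) = 0"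
  by (simp add: axial_def mat_def vec_eq_iff forall_3)

lemma axial_skew3 [simp]: "axial (skew3 x) = x"
  by (simp add: axial_def skew3_nth vec_eq_iff forall_3)

lemma axial_skew3_skew3: "axial (skew3 x ** skew3 y) = (1/2) *\<^sub>R (x \<times> y)"
  by (simp add: axial_def skew3_nth vec_eq_iff forall_3 matrix_matrix_mult_def sum_3 cross3_def)

lemma axial_skew3_skew3_skew3:
  "axial (skew3 u ** (skew3 x ** skew3 x)) = - ((x \<bullet> x) / 2) *\<^sub>R u - ((x \<bullet> u) / 2) *\<^sub>R x"
  by (simp add: axial_def skew3_nth vec_eq_iff forall_3 matrix_matrix_mult_def sum_3 inner_vec_def field_simps)

lemma trace_skew3 [simp]: "trace (skew3 x) = 0"
  by (simp add: trace_def skew3_nth sum_3)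

lemma trace_skew3_skew3: "trace (skew3 x ** skew3 y) = - 2 * (x \<bullet> y)"
  by (simp add: trace_def skew3_nth matrix_matrix_mult_def sum_3 inner_vec_def)

lemma trace_skew3_skew3_skew3: "trace (skew3 u ** (skew3 x ** skew3 x)) = 0"
  by (simp add: trace_def skew3_nth matrix_matrix_mult_def sum_3 algebra_simps)

text \<open>Closed form of the logarithm: the trace gives the cosine of the angle,
  \<open>axial\<close> gives the axis times the sine. Unlike \<open>so3_log\<close> it can be
  differentiated by the usual rules. At the identity the quotient defaults to 0, which is harmless
  because \<open>axial\<close> vanishes there.\<close>

definition rodrigues_log :: "real^3^3 \<Rightarrow> real^3" where
  "rodrigues_log Y = (arccos ((trace Y - 1) / 2) / sin (arccos ((trace Y - 1) / 2))) *\<^sub>R axial Y"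

lemma trace_so3_exp: "trace (so3_exp x) = 1 + 2 * cos (norm x)"
proof (cases "x = 0")
  case False
  have lin: "linear (trace :: real^3^3 \<Rightarrow> real)"
    by (rule bounded_linear.linear[OF bounded_linear_trace])
  show ?thesis
    using False
    by (simp add: Rodrigues linear_add[OF lin] linear_scale[OF lin] trace_skew3_skew3 trace_I power2_norm_eq_inner)
qed (simp add: Rodrigues trace_I)

lemma axial_so3_exp: "axial (so3_exp x) = (sin (norm x) / norm x) *\<^sub>R x"
  using bounded_linear.linear[OF bounded_linear_axial]
  by (simp add: Rodrigues linear_add linear_scale axial_skew3_skew3)

lemma rodrigues_log_exp:
  assumes "norm x < pi"
  shows "rodrigues_log (so3_exp x) = x"
proof -
  have "sin (norm x) > 0" if "x \<noteq> 0"
    using that assms by (intro sin_gt_zero) auto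
  then show ?thesis
    using assms by (cases "x = 0") (auto simp: rodrigues_log_def trace_so3_exp axial_so3_exp arccos_cos)
qed

lemma inj_on_so3_exp: "inj_on so3_exp (ball 0 pi)"
  by (rule inj_on_inverseI[where g = rodrigues_log]) (simp add: rodrigues_log_exp)

lemma so3_log_exp: "norm x < pi \<Longrightarrow> so3_log (so3_exp x) = x"
  unfolding so3_log_def by (rule inv_into_f_f[OF inj_on_so3_exp]) simp

lemma so3_log_domE:
  assumes "Y \<in> so3_log_dom"
  shows "norm (so3_log Y) < pi" "so3_exp (so3_log Y) = Y" "so3_log Y = rodrigues_log Y"
  using assms by (auto simp: so3_log_dom_def so3_log_exp rodrigues_log_exp)

text \<open>The punctured ball is a countable union of compact shells \<open>K n\<close>, whose
  images under the continuous map \<open>so3_exp\<close> are compact. The origin is treated apart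
  because the quotients in \<open>Rodrigues\<close> are continuous only where the norm is
  nonzero.\<close>

lemma so3_log_dom_borel [measurable]: "so3_log_dom \<in> sets borel"
proof -
  define K where "K n = {x::real^3. 1 / real (Suc n) \<le> norm x \<and> norm x \<le> pi - 1 / real (Suc n)}" for n
  have *: "ball 0 pi = {0} \<union> (\<Union>n. K n)"
  proof (intro set_eqI iffI)
    fix x :: "real^3" assume "x \<in> ball 0 pi"
    then have x: "norm x < pi" by simp
    show "x \<in> {0} \<union> (\<Union>n. K n)"
    proof (cases "x = 0")
      case False
      then obtain n where "inverse (real (Suc n)) < min (norm x) (pi - norm x)"
        using reals_Archimedean[of "min (norm x) (pi - norm x)"] x by auto
      then have "x \<in> K n" by (simp add: K_def inverse_eq_divide)
      then show ?thesis by blast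
    qed simp
  next
    fix x :: "real^3" assume "x \<in> {0} \<union> (\<Union>n. K n)"
    then consider "x = 0" | n where "x \<in> K n" by blast
    then show "x \<in> ball 0 pi"
    proof cases
      case 2
      have "0 < 1 / real (Suc n)" by simp
      then show ?thesis
        using 2 unfolding K_def mem_Collect_eq mem_ball dist_0_norm by linarith
    qed simp
  qed
  have "compact (K n)" for n
    unfolding compact_eq_bounded_closed
  proof
    show "bounded (K n)"
      by (rule boundedI[of _ pi]) (auto simp: K_def intro: order_trans)
    show "closed (K n)"
      unfolding K_def by (intro closed_Collect_conj closed_Collect_le continuous_intros)
  qed
  moreover have "continuous_on (K n) so3_exp" for n
  proof -
    have "\<forall>x\<in>K n. x \<noteq> 0" by (auto simp: K_def)
    moreover have "continuous_on S skew3" for S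
      by (intro linear_continuous_on bounded_linear_skew3)
    ultimately show ?thesis
      unfolding Rodrigues[abs_def]
      by (intro continuous_intros bounded_bilinear.continuous_on[OF bounded_bilinear_matrix_mult]) auto
  qed
  ultimately have "closed (so3_exp ` K n)" for n
    by (intro compact_imp_closed compact_continuous_image)
  then have "{so3_exp 0} \<union> (\<Union>n. so3_exp ` K n) \<in> sets borel"
    by (intro sets.Un sets.countable_UN borel_closed) auto
  then show ?thesis
    by (simp add: so3_log_dom_def * image_Un image_UN)
qed

lemma so3_log_borel [measurable]: "so3_log \<in> borel_measurable borel"
proof -
  \<comment> \<open>Clamping to the interval from -1 to 1 changes nothing on the domain and makes
    \<open>arccos\<close> continuous on the whole line. Off the domain, \<open>inv_into\<close>
    chooses from an empty predicate, hence returns the same value for every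
    \<open>Y\<close>.\<close>
  have eq: "so3_log Y = (if Y \<in> so3_log_dom then
       (arccos (max (-1) (min 1 ((trace Y - 1) / 2))) / sin (arccos (max (-1) (min 1 ((trace Y - 1) / 2))))) *\<^sub>R axial Y
     else (SOME x. False))" for Y
  proof (cases "Y \<in> so3_log_dom")
    case True
    then obtain x where "Y = so3_exp x" by (auto simp: so3_log_dom_def)
    then have "(trace Y - 1) / 2 = cos (norm x)" by (simp add: trace_so3_exp)
    then have "max (-1) (min 1 ((trace Y - 1) / 2)) = (trace Y - 1) / 2"
      by (simp add: max_def min_def) (smt (verit) cos_ge_minus_one cos_le_one)
    then show ?thesis using True by (simp add: so3_log_domE rodrigues_log_def)
  next
    case False
    then have "(\<lambda>x. x \<in> ball 0 pi \<and> so3_exp x = Y) = (\<lambda>x. False)"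
      by (auto simp: so3_log_dom_def)
    then show ?thesis using False by (simp add: so3_log_def inv_into_def)
  qed
  have [measurable]: "trace \<in> borel_measurable (borel :: (real^3^3) measure)"
    "axial \<in> borel_measurable borel"
    by (auto intro!: borel_measurable_continuous_onI linear_continuous_on bounded_linear_trace bounded_linear_axial)
  have [measurable]: "(\<lambda>c::real. arccos (max (-1) (min 1 c))) \<in> borel_measurable borel"
    by (intro borel_measurable_continuous_onI continuous_intros) auto
  have [measurable]: "sin \<in> borel_measurable (borel :: real measure)"
    by (intro borel_measurable_continuous_onI continuous_intros)
  show ?thesis
    unfolding eq[abs_def] by measurable
qed

subsection \<open>The differential of the logarithm\<close>

text \<open>The derivative of \<open>log (exp (t \<xi>) exp x)\<close> at \<open>t = 0\<close>, that is, the inverse left Jacobian of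
  \<open>SO(3)\<close> at \<open>x\<close> applied to \<open>\<xi>\<close>. The coefficient \<open>1 / \<theta>\<^sup>2 - (1 + cos \<theta>) / (2 \<theta> sin \<theta>)\<close> tends to
  \<open>1 / 12\<close> at \<open>0\<close>; its junk value at \<open>x = 0\<close> is harmless, being multiplied by \<open>0\<close>.\<close>

definition log_diff :: "real^3 \<Rightarrow> real^3 \<Rightarrow> real^3" where
  "log_diff x \<xi> = \<xi> + (1/2) *\<^sub>R (\<xi> \<times> x)
     + (1 / (norm x)\<^sup>2 - (1 + cos (norm x)) / (2 * norm x * sin (norm x))) *\<^sub>R (x \<times> (x \<times> \<xi>))"

text \<open>\<open>Rodrigues\<close> involves the absolute value of \<open>t\<close>, but both
  coefficients are even in the angle, so it may be replaced by \<open>t\<close>. The resulting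
  formula is visibly differentiable at 0.\<close>

lemma so3_exp_line:
  "so3_exp (t *\<^sub>R \<xi>) = mat 1 + (sin (t * norm \<xi>) / norm \<xi>) *\<^sub>R skew3 \<xi>
     + ((1 - cos (t * norm \<xi>)) / (norm \<xi>)\<^sup>2) *\<^sub>R (skew3 \<xi> ** skew3 \<xi>)"
  by (cases "t < 0"; cases "t = 0")
    (simp_all add: Rodrigues skew3_scaleR matrix_mult_scaleR power_mult_distrib power2_eq_square)

lemma so3_exp_line_deriv:
  "((\<lambda>t. so3_exp (t *\<^sub>R \<xi>)) has_vector_derivative skew3 \<xi>) (at 0)"
  unfolding so3_exp_line
  by (cases "\<xi> = 0") (auto intro!: derivative_eq_intros)

text \<open>Product rule for the scalar \<theta> / sin \<theta>, differentiated through the trace,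
  times the linear function \<open>axial\<close>. The condition on \<open>x\<close> puts cos
  \<theta> strictly between -1 and 1, where \<open>arccos\<close> is differentiable.\<close>

lemma rodrigues_log_deriv:
  assumes x: "0 < norm x" "norm x < pi"
    and Y: "(Y has_vector_derivative skew3 \<xi> ** so3_exp x) (at 0)" "Y 0 = so3_exp x"
  shows "((\<lambda>t. rodrigues_log (Y t)) has_vector_derivative log_diff x \<xi>) (at (0::real))"
proof -
  define \<theta> where "\<theta> = norm x"
  define S where "S = sin \<theta>"
  define K where "K = cos \<theta>"
  have \<theta>: "0 < \<theta>" "\<theta> < pi" using x by (simp_all add: \<theta>_def)
  have S: "S > 0" unfolding S_def by (rule sin_gt_zero) (use \<theta> in auto)
  have SK: "S * S + K * K = 1" using sin_cos_squared_add[of \<theta>] by (simp add: S_def K_def power2_eq_square)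
  have xx: "x \<bullet> x = \<theta> * \<theta>" by (simp add: \<theta>_def dot_square_norm power2_eq_square)
  have lin: "linear (trace :: real^3^3 \<Rightarrow> real)" "linear axial"
    by (rule bounded_linear.linear, rule bounded_linear_trace bounded_linear_axial)+
  have mm: "skew3 \<xi> ** so3_exp x = skew3 \<xi> + (S / \<theta>) *\<^sub>R (skew3 \<xi> ** skew3 x)
      + ((1 - K) / \<theta>\<^sup>2) *\<^sub>R (skew3 \<xi> ** (skew3 x ** skew3 x))"
    by (simp add: Rodrigues S_def K_def \<theta>_def matrix_mult_scaleR
        bounded_bilinear.add_right[OF bounded_bilinear_matrix_mult])
  have tr: "trace (skew3 \<xi> ** so3_exp x) = - 2 * (S / \<theta>) * (\<xi> \<bullet> x)"
    unfolding mm linear_add[OF lin(1)] linear_scale[OF lin(1)]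
    by (simp add: trace_skew3_skew3 trace_skew3_skew3_skew3)
  have ax: "axial (skew3 \<xi> ** so3_exp x) = \<xi> + (S / (2 * \<theta>)) *\<^sub>R (\<xi> \<times> x)
      + ((1 - K) / \<theta>\<^sup>2) *\<^sub>R (- (\<theta>\<^sup>2 / 2) *\<^sub>R \<xi> - ((x \<bullet> \<xi>) / 2) *\<^sub>R x)"
    unfolding mm linear_add[OF lin(2)] linear_scale[OF lin(2)]
    by (simp add: axial_skew3_skew3 axial_skew3_skew3_skew3 xx power2_eq_square)
  define c where "c t = (trace (Y t) - 1) / 2" for t
  have c0: "c 0 = K" by (simp add: c_def Y trace_so3_exp K_def \<theta>_def)
  have dc: "(c has_real_derivative - (S / \<theta>) * (\<xi> \<bullet> x)) (at 0)"
    unfolding c_def[abs_def]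
    using bounded_linear.has_vector_derivative[OF bounded_linear_trace Y(1)]
    unfolding has_real_derivative_iff_has_vector_derivative[symmetric] tr
    by (auto intro!: derivative_eq_intros)
  have K1: "-1 < K" "K < 1"
    using SK S abs_square_less_1[of K] mult_pos_pos[OF S S] by (auto simp: power2_eq_square abs_less_iff)
  have "sqrt (1 - K\<^sup>2) = S"
    using SK S by (intro real_sqrt_unique) (auto simp: power2_eq_square)
  then have da: "((\<lambda>t. arccos (c t)) has_real_derivative (\<xi> \<bullet> x) / \<theta>) (at 0)"
    using DERIV_chain2[OF DERIV_arccos dc] K1 S by (simp add: c0 mult.assoc[symmetric])
  have a0: "arccos (c 0) = \<theta>"
    unfolding c0 K_def using \<theta> by (intro arccos_cos) auto
  have dF: "((\<lambda>t. arccos (c t) / sin (arccos (c t))) has_real_derivative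
      ((S - \<theta> * K) / S\<^sup>2 * ((\<xi> \<bullet> x) / \<theta>))) (at 0)"
  proof (rule DERIV_chain2[OF _ da])
    show "((\<lambda>u. u / sin u) has_real_derivative (S - \<theta> * K) / S\<^sup>2) (at (arccos (c 0)))"
      unfolding a0 using S
      by (auto intro!: derivative_eq_intros simp: S_def K_def power2_eq_square)
  qed
  have dY: "((\<lambda>t. axial (Y t)) has_vector_derivative axial (skew3 \<xi> ** so3_exp x)) (at 0)"
    by (rule bounded_linear.has_vector_derivative[OF bounded_linear_axial Y(1)])
  have "((\<lambda>t. rodrigues_log (Y t)) has_vector_derivative
     (\<theta> / S) *\<^sub>R axial (skew3 \<xi> ** so3_exp x)
      + ((S - \<theta> * K) / S\<^sup>2 * ((\<xi> \<bullet> x) / \<theta>)) *\<^sub>R ((S / \<theta>) *\<^sub>R x)) (at 0)"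
    using has_vector_derivative_scaleR[OF dF dY]
    by (simp add: rodrigues_log_def c_def[symmetric] a0 S_def[symmetric] Y(2) axial_so3_exp \<theta>_def[symmetric])
  moreover have "(\<theta> / S) *\<^sub>R axial (skew3 \<xi> ** so3_exp x)
      + ((S - \<theta> * K) / S\<^sup>2 * ((\<xi> \<bullet> x) / \<theta>)) *\<^sub>R ((S / \<theta>) *\<^sub>R x) = log_diff x \<xi>"
  proof -
    \<comment> \<open>Both sides are compared as combinations of \<open>\<xi>\<close>,
      \<open>\<xi> \<times> x\<close> and \<open>x\<close>; the Lagrange formula brings the double
      cross product in \<open>log_diff\<close> to this form. Facts 1, 3 and 2 below match these
      three coefficients.\<close>
    have expand: "p *\<^sub>R (\<xi> + q *\<^sub>R w + r *\<^sub>R (- (m / 2) *\<^sub>R \<xi> - (k / 2) *\<^sub>R x)) + u *\<^sub>R (v *\<^sub>R x)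
      = (p * (1 - r * (m / 2))) *\<^sub>R \<xi> + (p * q) *\<^sub>R w + (p * (- r * (k / 2)) + u * v) *\<^sub>R x"
      for p q r m k u v :: real and w :: "real^3"
      by (simp add: algebra_simps)
    have 1: "(\<theta> / S) * (1 - (1 - K) / \<theta>\<^sup>2 * (\<theta>\<^sup>2 / 2)) = 1 - (1 / \<theta>\<^sup>2 - (1 + K) / (2 * \<theta> * S)) * \<theta>\<^sup>2"
      using S \<theta> by (simp add: field_simps power2_eq_square)
    have 2: "(\<theta> / S) * (- ((1 - K) / \<theta>\<^sup>2) * ((x \<bullet> \<xi>) / 2)) + ((S - \<theta> * K) / S\<^sup>2 * ((\<xi> \<bullet> x) / \<theta>)) * (S / \<theta>)
      = (1 / \<theta>\<^sup>2 - (1 + K) / (2 * \<theta> * S)) * (x \<bullet> \<xi>)"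
      using S \<theta> by (simp add: field_simps power2_eq_square inner_commute)
    have 3: "(\<theta> / S) * (S / (2 * \<theta>)) = 1 / 2" using S \<theta> by simp
    have "(\<theta> / S) *\<^sub>R axial (skew3 \<xi> ** so3_exp x)
      + ((S - \<theta> * K) / S\<^sup>2 * ((\<xi> \<bullet> x) / \<theta>)) *\<^sub>R ((S / \<theta>) *\<^sub>R x)
     = ((\<theta> / S) * (1 - (1 - K) / \<theta>\<^sup>2 * (\<theta>\<^sup>2 / 2))) *\<^sub>R \<xi> + ((\<theta> / S) * (S / (2 * \<theta>))) *\<^sub>R (\<xi> \<times> x)
       + ((\<theta> / S) * (- ((1 - K) / \<theta>\<^sup>2) * ((x \<bullet> \<xi>) / 2)) + ((S - \<theta> * K) / S\<^sup>2 * ((\<xi> \<bullet> x) / \<theta>)) * (S / \<theta>)) *\<^sub>R x"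
      unfolding ax by (rule expand)
    then show ?thesis
      unfolding 1 2 3 log_diff_def Lagrange xx \<theta>_def[symmetric] S_def[symmetric] K_def[symmetric]
      by (simp add: algebra_simps power2_eq_square)
  qed
  ultimately show ?thesis by simp
qed

text \<open>Unbiasedness only provides that \<open>exp (t \<xi>) Q\<close> lies in the domain of the logarithm almost surely
  for each fixed \<open>t\<close>, hence almost surely along a sequence; a sequence suffices to identify a
  derivative that is already known to exist.\<close>

lemma vector_derivative_eq_of_seq:
  fixes f g :: "real \<Rightarrow> 'a::real_normed_vector"
  assumes f: "(f has_vector_derivative D) (at a)" and g: "(g has_vector_derivative D') (at a)"
    and t: "t \<longlonglongrightarrow> a" "\<And>n. t n \<noteq> a" and eq: "\<And>n. f (t n) = g (t n)" "f a = g a"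
  shows "D = D'"
proof -
  have "filterlim t (at a) sequentially"
    using t by (simp add: filterlim_at)
  moreover have "((\<lambda>x. f x - g x) has_derivative (\<lambda>h. h *\<^sub>R (D - D'))) (at a)"
    using has_vector_derivative_diff[OF f g] by (simp add: has_vector_derivative_def)
  then have "((\<lambda>y. norm (f y - g y - (f a - g a) - (y - a) *\<^sub>R (D - D')) / norm (y - a)) \<longlongrightarrow> 0) (at a)"
    by (simp add: has_derivative_iff_norm)
  ultimately have "(\<lambda>n. norm (f (t n) - g (t n) - (f a - g a) - (t n - a) *\<^sub>R (D - D')) / norm (t n - a)) \<longlonglongrightarrow> 0"
    by (rule filterlim_compose[rotated])
  then have "(\<lambda>n::nat. norm (D - D')) \<longlonglongrightarrow> 0"
    using t(2) eq by simp
  then show ?thesis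
    by (simp add: LIMSEQ_const_iff)
qed

text \<open>Away from the identity, \<open>so3_log\<close> and \<open>rodrigues_log\<close> agree
  along the sequence \<open>t\<close>, so the derivative assumed to exist must be that of the closed
  form. At the identity the closed form is not differentiated: there the logarithm is just
  \<open>t *\<^sub>R \<xi>\<close> for small \<open>t\<close>.\<close>

lemma so3_log_line_deriv:
  assumes Q: "Q \<in> so3_log_dom"
    and diff: "(\<lambda>t. so3_log (so3_exp (t *\<^sub>R \<xi>) ** Q)) differentiable (at 0)"
    and t: "t \<longlonglongrightarrow> 0" "\<And>n. t n \<noteq> 0" "\<And>n. so3_exp (t n *\<^sub>R \<xi>) ** Q \<in> so3_log_dom"
  shows "((\<lambda>t. so3_log (so3_exp (t *\<^sub>R \<xi>) ** Q)) has_vector_derivative log_diff (so3_log Q) \<xi>) (at 0)"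
proof (cases "so3_log Q = 0")
  case True
  then have Q1: "Q = mat 1" using so3_log_domE(2)[OF Q] by (simp add: Rodrigues)
  have "((\<lambda>t. t *\<^sub>R \<xi>) has_vector_derivative log_diff (so3_log Q) \<xi>) (at 0)"
    unfolding True log_diff_def by (auto intro!: derivative_eq_intros)
  moreover have "eventually (\<lambda>t. t *\<^sub>R \<xi> \<in> ball 0 pi) (nhds (0::real))"
    by (rule topological_tendstoD[of "\<lambda>t. t *\<^sub>R \<xi>" 0])
      (auto intro!: tendsto_eq_intros filterlim_ident)
  then have "eventually (\<lambda>t. t *\<^sub>R \<xi> = so3_log (so3_exp (t *\<^sub>R \<xi>) ** Q)) (nhds (0::real))"
    by eventually_elim (simp add: Q1 so3_log_exp)
  ultimately show ?thesis
    using so3_log_exp[of 0] by (subst (asm) has_vector_derivative_cong_ev) (auto simp: Q1)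
next
  case False
  define x where "x = so3_log Q"
  have x: "0 < norm x" "norm x < pi" and Qx: "Q = so3_exp x"
    using so3_log_domE[OF Q] False by (auto simp: x_def)
  from diff obtain D where D: "((\<lambda>t. so3_log (so3_exp (t *\<^sub>R \<xi>) ** Q)) has_vector_derivative D) (at 0)"
    by (metis vector_derivative_works)
  have "((\<lambda>t. so3_exp (t *\<^sub>R \<xi>) ** Q) has_vector_derivative skew3 \<xi> ** Q) (at 0)"
    using bounded_linear.has_vector_derivative[OF bounded_bilinear.bounded_linear_left[OF bounded_bilinear_matrix_mult] so3_exp_line_deriv] .
  then have D': "((\<lambda>t. rodrigues_log (so3_exp (t *\<^sub>R \<xi>) ** Q)) has_vector_derivative log_diff x \<xi>) (at 0)"
    by (intro rodrigues_log_deriv x) (auto simp: Qx[symmetric])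
  have "D = log_diff x \<xi>"
    by (rule vector_derivative_eq_of_seq[OF D D' t(1,2)])
      (use t(3) Q in \<open>auto simp: so3_log_domE\<close>)
  with D show ?thesis by (simp add: x_def)
qed

text \<open>In the half angle \<phi> the expression becomes
  \<open>N \<phi> / (4 * \<phi>\<^sup>2 * sin \<phi>)\<close>, with no singularity at \<theta> = pi
  since sin \<phi> stays away from 0 there. The derivative of \<open>N\<close> is
  \<open>z / 3 * f z\<close>, and \<open>f\<close> lies between 0 and the cube of its argument, so
  \<open>N\<close> lies between 0 and the fifth power.\<close>

lemma log_diff_coeff_bound:
  fixes \<theta> :: real
  assumes "0 < \<theta>" "\<theta> < pi"
  shows "\<bar>1 / \<theta>\<^sup>2 - (1 + cos \<theta>) / (2 * \<theta> * sin \<theta>) - 1 / 12\<bar> \<le> \<theta> / 2"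
proof -
  define \<phi> where "\<phi> = \<theta> / 2"
  have \<phi>: "0 < \<phi>" "\<phi> < pi / 2" "\<theta> = 2 * \<phi>" using assms by (simp_all add: \<phi>_def)
  have \<phi>2: "\<phi> < 1.6" using \<phi> pi_approx by simp
  define f where "f y = sin y - y * cos y" for y :: real
  define N where "N y = f y - y\<^sup>2 * sin y / 3" for y :: real
  have f0: "0 \<le> f y" "f y \<le> y^3" if "0 \<le> y" "y \<le> \<phi>" for y
  proof -
    have d: "(f has_real_derivative z * sin z) (at z)" for z
      unfolding f_def[abs_def] by (auto intro!: derivative_eq_intros)
    have sz: "0 \<le> sin z" "sin z \<le> z" if "0 \<le> z" "z \<le> \<phi>" for z
      using that \<phi> by (auto intro!: sin_ge_zero sin_x_le_x)
    have "f 0 \<le> f y"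
      by (rule DERIV_nonneg_imp_nondecreasing[OF that(1)]) (use d sz that in fastforce)
    then show "0 \<le> f y" by (simp add: f_def)
    have "(\<lambda>y. f y - y^3) y \<le> (\<lambda>y. f y - y^3) 0"
    proof (rule DERIV_nonpos_imp_nonincreasing[where f = "\<lambda>y. f y - y^3", OF that(1)])
      fix z assume z: "0 \<le> z" "z \<le> y"
      have "((\<lambda>y. f y - y^3) has_real_derivative z * sin z - 3 * z^2) (at z)"
        by (auto intro!: derivative_eq_intros d)
      moreover have "z * sin z \<le> z * z" using sz[of z] z that by (intro mult_left_mono) auto
      then have "z * sin z - 3 * z\<^sup>2 \<le> 0"
        using zero_le_square[of z] unfolding power2_eq_square by linarith
      ultimately show "\<exists>D. ((\<lambda>y. f y - y^3) has_real_derivative D) (at z) \<and> D \<le> 0"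
        by blast
    qed
    then show "f y \<le> y^3" by (simp add: f_def)
  qed
  have dN: "(N has_real_derivative z / 3 * f z) (at z)" for z
    unfolding N_def[abs_def] f_def[abs_def] by (auto intro!: derivative_eq_intros simp: algebra_simps power2_eq_square)
  have "N 0 \<le> N \<phi>"
  proof (rule DERIV_nonneg_imp_nondecreasing[where f = N])
    fix z assume "0 \<le> z" "z \<le> \<phi>"
    then have "0 \<le> z / 3 * f z" using f0 by simp
    with dN show "\<exists>D. (N has_real_derivative D) (at z) \<and> 0 \<le> D" by blast
  qed (use \<phi> in auto)
  then have N0: "0 \<le> N \<phi>" by (simp add: N_def f_def)
  have "(\<lambda>y. N y - y^5) \<phi> \<le> (\<lambda>y. N y - y^5) 0"
  proof (rule DERIV_nonpos_imp_nonincreasing[where f = "\<lambda>y. N y - y^5"])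
    fix z assume z: "0 \<le> z" "z \<le> \<phi>"
    have "((\<lambda>y. N y - y^5) has_real_derivative z / 3 * f z - 5 * z^4) (at z)"
      by (auto intro!: derivative_eq_intros dN)
    moreover have "z / 3 * f z \<le> z / 3 * z^3" using f0[of z] z by (intro mult_left_mono) auto
    then have "z / 3 * f z - 5 * z^4 \<le> 0"
      using zero_le_power[OF z(1), of 4] by (simp add: power_def numeral_eq_Suc)
    ultimately show "\<exists>D. ((\<lambda>y. N y - y^5) has_real_derivative D) (at z) \<and> D \<le> 0" by blast
  qed (use \<phi> in auto)
  then have N1: "N \<phi> \<le> \<phi>^5" by (simp add: N_def f_def)
  \<comment> \<open>The inequality sin y \<ge> y - \<open>y^3 / 6\<close> is used up to \<phi> <
    1.6; there the square of \<phi> is below 3, so the cubic term costs at most half of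
    \<phi>.\<close>
  have S: "\<phi> / 2 \<le> sin \<phi>"
  proof -
    have "(\<lambda>y. sin y - y + y^3 / 6) 0 \<le> (\<lambda>y. sin y - y + y^3 / 6) \<phi>"
    proof (rule DERIV_nonneg_imp_nondecreasing[where f = "\<lambda>y. sin y - y + y^3 / 6"])
      fix z :: real
      have "((\<lambda>y. sin y - y + y^3 / 6) has_real_derivative cos z - 1 + z\<^sup>2 / 2) (at z)"
        by (auto intro!: derivative_eq_intros)
      moreover have "(sin (z / 2))\<^sup>2 \<le> (z / 2)\<^sup>2"
        by (rule abs_le_square_iff[THEN iffD1]) (rule abs_sin_x_le_abs_x)
      then have "0 \<le> cos z - 1 + z\<^sup>2 / 2"
        using cos_double_sin[of "z / 2"] by (simp add: power_divide)
      ultimately show "\<exists>D. ((\<lambda>y. sin y - y + y^3 / 6) has_real_derivative D) (at z) \<and> 0 \<le> D"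
        by blast
    qed (use \<phi> in auto)
    moreover have "\<phi>^3 / 6 \<le> \<phi> / 2"
    proof -
      have "\<phi> * \<phi> \<le> 1.6 * 1.6" using \<phi> \<phi>2 by (intro mult_mono) auto
      then have "\<phi> * (\<phi> * \<phi>) \<le> \<phi> * 3" using \<phi> by (intro mult_left_mono) auto
      then show ?thesis by (simp add: power3_eq_cube mult.assoc)
    qed
    ultimately show ?thesis by simp
  qed
  have S0: "sin \<phi> > 0" using S \<phi> by linarith
  have C0: "cos \<phi> > 0" using \<phi> by (intro cos_gt_zero) auto
  have "1 / \<theta>\<^sup>2 - (1 + cos \<theta>) / (2 * \<theta> * sin \<theta>) - 1 / 12 = N \<phi> / (4 * \<phi>\<^sup>2 * sin \<phi>)"
    unfolding \<phi>(3) sin_double cos_double_cos N_def f_def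
    using S0 C0 \<phi>(1) by (simp add: field_simps power2_eq_square)
  moreover have "0 \<le> N \<phi> / (4 * \<phi>\<^sup>2 * sin \<phi>)" using N0 S0 by simp
  moreover have "N \<phi> / (4 * \<phi>\<^sup>2 * sin \<phi>) \<le> \<phi>"
  proof -
    have "N \<phi> \<le> \<phi>^5" by (rule N1)
    also have "\<dots> = \<phi>^4 * \<phi>" by (simp add: power_def numeral_eq_Suc)
    also have "\<dots> \<le> \<phi>^4 * (2 * sin \<phi>)" using S by (intro mult_left_mono) auto
    also have "\<dots> = 2 * \<phi> * (\<phi>^3 * sin \<phi>)" by (simp add: power_def numeral_eq_Suc)
    also have "\<dots> \<le> 4 * (\<phi>^3 * sin \<phi>)" using \<phi>2 S0 \<phi> by (intro mult_right_mono) auto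
    finally show ?thesis using S0 \<phi> by (simp add: field_simps power2_eq_square power3_eq_cube)
  qed
  ultimately show ?thesis by (simp add: \<phi>(3))
qed

subsection \<open>Gaussian moments and the score\<close>

text \<open>Fubini: Lebesgue measure is the image of a product measure indexed by
  \<open>Basis\<close>, which \<open>axis\<close> puts in bijection with the coordinates.\<close>

lemma integral_lborel_vec_prod:
  fixes f :: "'n::finite \<Rightarrow> real \<Rightarrow> real"
  assumes f: "\<And>i. integrable lborel (f i)"
  shows "integrable lborel (\<lambda>x::real^'n. \<Prod>i\<in>UNIV. f i (x $ i))"
    and "(\<integral>x. (\<Prod>i\<in>UNIV. f i (x $ i)) \<partial>lborel) = (\<Prod>i\<in>UNIV. \<integral>y. f i y \<partial>lborel)"
proof -
  define ax where "ax = (\<lambda>i::'n. axis i (1::real))"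
  have inj: "inj ax" by (auto simp: inj_def ax_def axis_eq_axis)
  have B: "Basis = range ax" by (auto simp: Basis_vec_def ax_def)
  define g where "g b = f (inv ax b)" for b
  have g: "g (ax i) = f i" for i by (simp add: g_def inj)
  have gi: "integrable lborel (g b)" for b by (simp add: g_def f)
  have eq: "(\<Prod>i\<in>UNIV. f i (x $ i)) = (\<Prod>b\<in>Basis. g b (x \<bullet> b))" for x :: "real^'n"
    unfolding B by (subst prod.reindex[OF inj]) (simp add: g, simp add: ax_def inner_axis)
  interpret L: product_sigma_finite "\<lambda>_::real^'n. lborel :: real measure" ..
  have [measurable]: "f i \<in> borel_measurable borel" "g b \<in> borel_measurable borel" for i b
    using borel_measurable_integrable[OF f] borel_measurable_integrable[OF gi] by auto
  have inner: "(\<Sum>b\<in>Basis. y b *\<^sub>R b) \<bullet> b = y b" if "b \<in> Basis" for y :: "real^'n \<Rightarrow> real" and b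
    using that by simp
  have prod: "(\<Prod>b\<in>Basis. g b ((\<Sum>b\<in>Basis. y b *\<^sub>R b) \<bullet> b)) = (\<Prod>b\<in>Basis. g b (y b))" for y
    by (intro prod.cong refl) simp
  have m: "(\<lambda>y. \<Sum>b\<in>Basis. y b *\<^sub>R b) \<in> (\<Pi>\<^sub>M b\<in>(Basis::(real^'n) set). lborel) \<rightarrow>\<^sub>M (borel :: (real^'n) measure)"
    by measurable
  have lb: "(lborel :: (real^'n) measure) = distr (\<Pi>\<^sub>M b\<in>Basis. lborel) borel (\<lambda>y. \<Sum>b\<in>Basis. y b *\<^sub>R b)"
    by (simp add: lborel_eq_real lborel_def[where 'a="real^'n"])
  show "integrable lborel (\<lambda>x::real^'n. \<Prod>i\<in>UNIV. f i (x $ i))"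
    unfolding eq lb
    by (subst integrable_distr_eq[OF m]) (auto simp: prod intro!: L.product_integrable_prod gi)
  have "(\<integral>x. (\<Prod>i\<in>UNIV. f i (x $ i)) \<partial>(lborel :: (real^'n) measure)) = (\<Prod>b\<in>Basis. \<integral>y. g b y \<partial>lborel)"
    unfolding eq lb
    by (subst integral_distr[OF m]) (auto simp: prod intro!: L.product_integral_prod gi)
  also have "\<dots> = (\<Prod>i\<in>UNIV. \<integral>y. f i y \<partial>lborel)"
    unfolding B by (subst prod.reindex[OF inj]) (simp add: g)
  finally show "(\<integral>x. (\<Prod>i\<in>UNIV. f i (x $ i)) \<partial>(lborel :: (real^'n) measure)) = (\<Prod>i\<in>UNIV. \<integral>y. f i y \<partial>lborel)" .
qed

lemma gauss3_moments:
  assumes s: "0 < s"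
  defines "N \<equiv> density lborel (\<lambda>v. ennreal (gauss3_density 0 s v))"
  shows "has_bochner_integral N (\<lambda>v. v $ i) 0"
    and "has_bochner_integral N (\<lambda>v. v $ i * v $ j) (if i = j then s\<^sup>2 else 0)"
proof -
  have n0: "has_bochner_integral lborel (normal_density 0 s) 1"
    using s by (simp add: has_bochner_integral_iff)
  have n1: "has_bochner_integral lborel (\<lambda>x. normal_density 0 s x * x) 0"
    using normal_moment_nz_1[OF s, of 0] .
  have n2: "has_bochner_integral lborel (\<lambda>x. normal_density 0 s x * x * x) (s\<^sup>2)"
    using normal_moment_even[OF s, of 0 1] s by (simp add: power2_eq_square mult.assoc field_simps)
  \<comment> \<open>Each moment needed is that of a product over all coordinates, with factor 1 in
    the coordinates not involved. A coordinate occurring exactly once contributes mean 0.\<close>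
  have *: "has_bochner_integral N (\<lambda>v. \<Prod>l\<in>UNIV. h l (v $ l)) (\<Prod>l\<in>UNIV. I l)"
    if h: "\<And>l. has_bochner_integral lborel (\<lambda>x. normal_density 0 s x * h l x) (I l)"
      and [measurable]: "\<And>l. h l \<in> borel_measurable borel" for h :: "3 \<Rightarrow> real \<Rightarrow> real" and I
  proof -
    have "integrable lborel (\<lambda>v::real^3. \<Prod>l\<in>UNIV. normal_density 0 s (v $ l) * h l (v $ l))"
      "(\<integral>v. (\<Prod>l\<in>UNIV. normal_density 0 s (v $ l) * h l (v $ l)) \<partial>(lborel :: (real^3) measure)) = (\<Prod>l\<in>UNIV. I l)"
      using integral_lborel_vec_prod[of "\<lambda>l x. normal_density 0 s x * h l x"] h
      by (auto simp: has_bochner_integral_iff)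
    then have "has_bochner_integral lborel (\<lambda>v::real^3. gauss3_density 0 s v *\<^sub>R (\<Prod>l\<in>UNIV. h l (v $ l))) (\<Prod>l\<in>UNIV. I l)"
      by (simp add: has_bochner_integral_iff gauss3_density_def prod.distrib)
    then show ?thesis
      unfolding N_def by (intro has_bochner_integral_density) auto
  qed
  show "has_bochner_integral N (\<lambda>v. v $ i) 0"
    using *[of "\<lambda>l x. if l = i then x else 1" "\<lambda>l. if l = i then 0 else 1"] n0 n1
    by (auto simp: prod.delta)
  show "has_bochner_integral N (\<lambda>v. v $ i * v $ j) (if i = j then s\<^sup>2 else 0)"
  proof (cases "i = j")
    case True
    then show ?thesis
      using *[of "\<lambda>l x. if l = i then x * x else 1" "\<lambda>l. if l = i then s\<^sup>2 else 1"] n0 n2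
      by (auto simp: prod.delta mult.assoc)
  next
    case False
    have "(\<Prod>l\<in>UNIV. (if l = i then 0 else 1) * (if l = j then 0 else 1 :: real)) = 0"
      by (auto simp: prod.distrib prod.delta)
    moreover have "(\<Prod>l\<in>UNIV. (if l = i then v $ l else 1) * (if l = j then v $ l else 1)) = v $ i * v $ j"
      for v :: "real^3" by (auto simp: prod.distrib prod.delta)
    moreover have "has_bochner_integral lborel
        (\<lambda>x. normal_density 0 s x * ((if l = i then x else 1) * (if l = j then x else 1)))
        ((if l = i then 0 else 1) * (if l = j then 0 else 1))" for l
      using n0 n1 False by (cases "l = i"; cases "l = j") auto
    moreover have "(\<lambda>x::real. (if l = i then x else 1) * (if l = j then x else 1)) \<in> borel_measurable borel" for l
      by measurable
    ultimately show ?thesis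
      using *[of "\<lambda>l x. (if l = i then x else 1) * (if l = j then x else 1)"
          "\<lambda>l. (if l = i then 0 else 1) * (if l = j then 0 else 1)"] False
      by (simp only: if_False)
  qed
qed

lemma gauss3_inner_moments:
  assumes s: "0 < s"
  defines "N \<equiv> density lborel (\<lambda>v. ennreal (gauss3_density 0 s v))"
  shows "has_bochner_integral N (\<lambda>v. c \<bullet> v) 0"
    and "has_bochner_integral N (\<lambda>v. (c \<bullet> v)\<^sup>2) (s\<^sup>2 * (norm c)\<^sup>2)"
proof -
  have "has_bochner_integral N (\<lambda>v. \<Sum>i\<in>UNIV. c $ i * v $ i) (\<Sum>i\<in>UNIV. c $ i * 0)"
    unfolding N_def by (intro has_bochner_integral_sum has_bochner_integral_mult_right gauss3_moments s)
  then show "has_bochner_integral N (\<lambda>v. c \<bullet> v) 0"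
    by (simp add: inner_vec_def)
  have "has_bochner_integral N (\<lambda>v. \<Sum>i\<in>UNIV. \<Sum>j\<in>UNIV. (c $ i * c $ j) * (v $ i * v $ j))
      (\<Sum>i\<in>UNIV. \<Sum>j\<in>UNIV. (c $ i * c $ j) * (if i = j then s\<^sup>2 else 0))"
    unfolding N_def by (intro has_bochner_integral_sum has_bochner_integral_mult_right gauss3_moments s)
  moreover have "(\<Sum>i\<in>UNIV. \<Sum>j\<in>UNIV. (c $ i * c $ j) * (v $ i * v $ j)) = (c \<bullet> v)\<^sup>2" for v
    by (simp add: inner_vec_def power2_eq_square sum_product mult_ac)
  moreover have "(\<Sum>i\<in>UNIV. \<Sum>j\<in>UNIV. (c $ i * c $ j) * (if i = j then s\<^sup>2 else 0)) = s\<^sup>2 * (norm c)\<^sup>2"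
    by (simp add: power2_norm_eq_inner inner_vec_def sum_distrib_left mult_ac if_distrib sum.delta cong: if_cong)
  ultimately show "has_bochner_integral N (\<lambda>v. (c \<bullet> v)\<^sup>2) (s\<^sup>2 * (norm c)\<^sup>2)"
    by simp
qed

text \<open>After expanding the square, the expectation of an off-diagonal term factors by
  independence into vanishing means, so only the individual variances remain.\<close>

lemma (in product_prob_space) second_moment_sum:
  fixes Y :: "'i \<Rightarrow> 'a \<Rightarrow> real"
  assumes fin: "finite I"
    and Y1: "\<And>k. k \<in> I \<Longrightarrow> has_bochner_integral (M k) (Y k) 0"
    and Y2: "\<And>k. k \<in> I \<Longrightarrow> has_bochner_integral (M k) (\<lambda>v. (Y k v)\<^sup>2) (\<tau> k)"
  shows "has_bochner_integral (Pi\<^sub>M I M) (\<lambda>V. (\<Sum>k\<in>I. Y k (V k))\<^sup>2) (\<Sum>k\<in>I. \<tau> k)"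
proof -
  have *: "has_bochner_integral (Pi\<^sub>M I M) (\<lambda>V. \<Prod>k\<in>I. h k (V k)) (\<Prod>k\<in>I. J k)"
    if "\<And>k. k \<in> I \<Longrightarrow> has_bochner_integral (M k) (h k) (J k)" for h :: "'i \<Rightarrow> 'a \<Rightarrow> real" and J
    using that product_integrable_prod[OF fin, of h] product_integral_prod[OF fin, of h]
    by (auto simp: has_bochner_integral_iff cong: prod.cong)
  have one: "has_bochner_integral (M k) (\<lambda>_. 1::real) 1" for k
    using M.prob_space[of k] by (simp add: has_bochner_integral_iff)
  have pair: "has_bochner_integral (Pi\<^sub>M I M) (\<lambda>V. Y j (V j) * Y k (V k)) (if j = k then \<tau> j else 0)"
    if jk: "j \<in> I" "k \<in> I" for j k
  proof (cases "j = k")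
    case True
    then show ?thesis
      using *[of "\<lambda>l x. if l = j then (Y l x)\<^sup>2 else 1" "\<lambda>l. if l = j then \<tau> l else 1"] Y2 one jk fin
      by (auto simp: prod.delta power2_eq_square)
  next
    case False
    have "(\<Prod>l\<in>I. (if l = j then 0 else 1) * (if l = k then 0 else 1 :: real)) = 0"
      using jk fin by (auto simp: prod.distrib prod.delta)
    moreover have "(\<Prod>l\<in>I. (if l = j then Y l (V l) else 1) * (if l = k then Y l (V l) else 1)) = Y j (V j) * Y k (V k)"
      for V using jk fin by (auto simp: prod.distrib prod.delta)
    moreover have "has_bochner_integral (M l) (\<lambda>x. (if l = j then Y l x else 1) * (if l = k then Y l x else 1))
        ((if l = j then 0 else 1) * (if l = k then 0 else 1))" if "l \<in> I" for l
      using Y1[OF that] one[of l] False by (cases "l = j"; cases "l = k") auto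
    ultimately show ?thesis
      using *[of "\<lambda>l x. (if l = j then Y l x else 1) * (if l = k then Y l x else 1)"
          "\<lambda>l. (if l = j then 0 else 1) * (if l = k then 0 else 1)"] False
      by simp
  qed
  have "has_bochner_integral (Pi\<^sub>M I M) (\<lambda>V. \<Sum>j\<in>I. \<Sum>k\<in>I. Y j (V j) * Y k (V k))
     (\<Sum>j\<in>I. \<Sum>k\<in>I. if j = k then \<tau> j else 0)"
    by (intro has_bochner_integral_sum pair)
  then show ?thesis
    using fin by (simp add: power2_eq_square sum_product sum.delta)
qed

text \<open>The derivative at \<open>t = 0\<close> of the log-likelihood along
  \<open>so3_exp (t *\<^sub>R \<xi>) ** R\<close>. The vector
  \<open>transpose R *v (d k \<times> \<xi>)\<close> is the velocity of the mean of measurement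
  \<open>k\<close>.\<close>

definition wahba_score ::
  "nat \<Rightarrow> (nat \<Rightarrow> real^3) \<Rightarrow> (nat \<Rightarrow> real) \<Rightarrow> real^3^3 \<Rightarrow> real^3 \<Rightarrow> (nat \<Rightarrow> real^3) \<Rightarrow> real" where
  "wahba_score n d \<sigma> R \<xi> X =
     (\<Sum>k<n. (1 / (\<sigma> k)\<^sup>2) * ((transpose R *v (d k \<times> \<xi>)) \<bullet> (X k - transpose R *v d k)))"

text \<open>The bilinear form, rather than the quadratic one, gives both the variance of the score
  and the symmetry of the information matrix.\<close>

lemma inner_wahba_info:
  "u \<bullet> (wahba_info n d \<sigma> *v w) = (\<Sum>k<n. (1 / (\<sigma> k)\<^sup>2) * ((d k \<times> u) \<bullet> (d k \<times> w)))"
proof -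
  have "u \<bullet> (transpose (skew3 a) ** skew3 a *v w) = (a \<times> u) \<bullet> (a \<times> w)" for a
    by (simp add: matrix_vector_mul_assoc[symmetric] inner_commute[of u] dot_lmul_matrix) (rule inner_commute)
  moreover have "(\<Sum>k<n. A k) *v w = (\<Sum>k<n. A k *v w)" for A :: "nat \<Rightarrow> real^3^3"
    by (induction n) (auto simp: matrix_vector_mult_add_rdistrib)
  ultimately show ?thesis
    by (simp add: wahba_info_def inner_sum_right scaleR_matrix_vector_assoc[symmetric])
qed

text \<open>In terms of the noise the score is a sum of independent centred linear forms, so
  variances add. Orthogonality of \<open>R\<close> removes it from the norms, which is why the
  information is the same at every rotation.\<close>

lemma wahba_score_second_moment:
  assumes \<sigma>: "\<And>k. k < n \<Longrightarrow> 0 < \<sigma> k" and R: "rotation_matrix R"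
  shows "has_bochner_integral (wahba_law n d \<sigma> R) (\<lambda>X. (wahba_score n d \<sigma> R \<xi> X)\<^sup>2)
     (\<xi> \<bullet> (wahba_info n d \<sigma> *v \<xi>))"
proof -
  define s where "s k = (if k < n then \<sigma> k else 1)" for k
  have s: "0 < s k" for k using \<sigma> by (simp add: s_def)
  define N where "N k = density lborel (\<lambda>v. ennreal (gauss3_density 0 (s k) v))" for k
  define b where "b k = (1 / (\<sigma> k)\<^sup>2) *\<^sub>R (transpose R *v (d k \<times> \<xi>))" for k
  interpret N: product_prob_space N "{..<n}"
    by (intro product_prob_spaceI) (simp add: N_def prob_space_gauss3 s)
  have noise: "noise_law n \<sigma> = Pi\<^sub>M {..<n} N"
    unfolding noise_law_def N_def by (intro PiM_cong) (auto simp: s_def)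
  have setsN: "sets (Pi\<^sub>M {..<n} N) = sets (\<Pi>\<^sub>M k\<in>{..<n}. borel)"
    by (intro sets_PiM_cong) (auto simp: N_def)
  have meas: "(\<lambda>V. \<lambda>k\<in>{..<n}. transpose R *v d k + V k) \<in> measurable (Pi\<^sub>M {..<n} N) (\<Pi>\<^sub>M k\<in>{..<n}. borel)"
    by (subst measurable_cong_sets[OF setsN refl]) measurable
  have score: "wahba_score n d \<sigma> R \<xi> (\<lambda>k\<in>{..<n}. transpose R *v d k + V k) = (\<Sum>k<n. b k \<bullet> V k)" for V
    by (auto simp: wahba_score_def b_def intro!: sum.cong)
  have mscore: "wahba_score n d \<sigma> R \<xi> \<in> borel_measurable (\<Pi>\<^sub>M k\<in>{..<n}. borel)"
    unfolding wahba_score_def by measurable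
  have "has_bochner_integral (Pi\<^sub>M {..<n} N) (\<lambda>V. (\<Sum>k<n. b k \<bullet> V k)\<^sup>2) (\<Sum>k<n. (s k)\<^sup>2 * (norm (b k))\<^sup>2)"
    by (rule N.second_moment_sum) (auto simp: N_def intro!: gauss3_inner_moments s)
  moreover have "(\<Sum>k<n. (s k)\<^sup>2 * (norm (b k))\<^sup>2) = \<xi> \<bullet> (wahba_info n d \<sigma> *v \<xi>)"
  proof -
    have "orthogonal_matrix (transpose R)"
      using R by (simp add: rotation_matrix_def orthogonal_matrix_transpose)
    then have "norm (transpose R *v u) = norm u" for u
      using orthogonal_transformation_matrix[of "(*v) (transpose R)"]
      by (auto simp: orthogonal_transformation)
    then have "(s k)\<^sup>2 * (norm (b k))\<^sup>2 = (1 / (\<sigma> k)\<^sup>2) * ((d k \<times> \<xi>) \<bullet> (d k \<times> \<xi>))" if "k < n" for k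
      using \<sigma>[OF that] that
      by (simp add: b_def s_def power2_norm_eq_inner[symmetric] power_divide field_simps power2_eq_square)
    then show ?thesis by (simp add: inner_wahba_info)
  qed
  ultimately show ?thesis
    unfolding wahba_law_def noise
    using meas mscore by (auto intro!: has_bochner_integral_distr simp: score simp del: transpose_matrix_vector)
qed

lemma gauss3_density_eq:
  "gauss3_density m s v = (1 / sqrt (2 * pi * s\<^sup>2)) ^ 3 * exp (- ((v - m) \<bullet> (v - m)) / (2 * s\<^sup>2))"
proof -
  have "gauss3_density m s v = (\<Prod>i\<in>UNIV. 1 / sqrt (2 * pi * s\<^sup>2) * exp (- (v $ i - m $ i)\<^sup>2 / (2 * s\<^sup>2)))"
    by (simp only: gauss3_density_def normal_density_def)
  also have "\<dots> = (1 / sqrt (2 * pi * s\<^sup>2)) ^ 3 * exp (\<Sum>i\<in>UNIV. - (v $ i - m $ i)\<^sup>2 / (2 * s\<^sup>2))"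
    by (simp only: prod.distrib prod_constant exp_sum[OF finite] card_num1) simp
  also have "(\<Sum>i\<in>UNIV. - (v $ i - m $ i)\<^sup>2 / (2 * s\<^sup>2)) = - ((v - m) \<bullet> (v - m)) / (2 * s\<^sup>2)"
    by (simp add: inner_vec_def sum_divide_distrib[symmetric] sum_negf power2_eq_square)
  finally show ?thesis .
qed

lemma wahba_density_pos:
  assumes "\<And>k. k < n \<Longrightarrow> 0 < \<sigma> k"
  shows "0 < wahba_density n d \<sigma> R X"
  using assms by (auto simp: wahba_density_def gauss3_density_def intro!: prod_pos normal_density_pos)

text \<open>The density is a constant times the exponential of a sum of quadratics, since the
  normalising factors do not depend on \<open>t\<close>; its logarithmic derivative is therefore a
  plain sum. Transposing \<open>skew3 \<xi>\<close> flips its sign, which turns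
  \<open>\<xi> \<times> d k\<close> into \<open>d k \<times> \<xi>\<close>.\<close>

lemma wahba_density_deriv:
  assumes \<sigma>: "\<And>k. k < n \<Longrightarrow> 0 < \<sigma> k"
  shows "((\<lambda>t. wahba_density n d \<sigma> (so3_exp (t *\<^sub>R \<xi>) ** R) X) has_real_derivative
     wahba_density n d \<sigma> R X * wahba_score n d \<sigma> R \<xi> X) (at 0)"
proof -
  define m where "m k t = transpose (so3_exp (t *\<^sub>R \<xi>) ** R) *v d k" for k t
  have m0: "m k 0 = transpose R *v d k" for k by (simp add: m_def)
  have "bounded_linear (\<lambda>A. transpose (A ** R) *v d k)" for k
    by (rule linear_conv_bounded_linear[THEN iffD1])
      (auto simp: linear_iff matrix_transpose_mul bounded_bilinear.add_left[OF bounded_bilinear_matrix_mult]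
        bounded_bilinear.scaleR_left[OF bounded_bilinear_matrix_mult] transpose_def matrix_vector_mult_def
        vec_eq_iff sum.distrib sum_distrib_left algebra_simps)
  then have "(m k has_vector_derivative transpose (skew3 \<xi> ** R) *v d k) (at 0)" for k
    unfolding m_def[abs_def] by (rule bounded_linear.has_vector_derivative[OF _ so3_exp_line_deriv])
  also have "transpose (skew3 \<xi> ** R) *v d k = transpose R *v (d k \<times> \<xi>)" for k
    using matrix_vector_mult_diff_rdistrib[of 0 "skew3 \<xi>" "d k"]
    by (simp add: matrix_transpose_mul transpose_skew3 matrix_vector_mul_assoc[symmetric] cross_skew[of "d k"]
        del: transpose_matrix_vector)
  finally have dm: "(m k has_vector_derivative transpose R *v (d k \<times> \<xi>)) (at 0)" for k .
  define q where "q k t = - ((X k - m k t) \<bullet> (X k - m k t)) / (2 * (\<sigma> k)\<^sup>2)" for k t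
  have dq: "(q k has_real_derivative (1 / (\<sigma> k)\<^sup>2) * ((transpose R *v (d k \<times> \<xi>)) \<bullet> (X k - transpose R *v d k))) (at 0)"
    if "k < n" for k
    unfolding q_def[abs_def] has_field_derivative_def
    using dm[of k] \<sigma>[OF that] unfolding has_vector_derivative_def
    by (auto intro!: derivative_eq_intros simp: m0 fun_eq_iff inner_commute inner_diff_left inner_diff_right field_simps)
  define C where "C = (\<Prod>k<n. (1 / sqrt (2 * pi * (\<sigma> k)\<^sup>2)) ^ 3)"
  have eq: "wahba_density n d \<sigma> (so3_exp (t *\<^sub>R \<xi>) ** R) X = C * exp (\<Sum>k<n. q k t)" for t
    unfolding wahba_density_def C_def exp_sum[OF finite_lessThan] prod.distrib[symmetric]
    by (intro prod.cong refl) (simp add: gauss3_density_eq m_def q_def)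
  have "((\<lambda>t. C * exp (\<Sum>k<n. q k t)) has_real_derivative
      C * (exp (\<Sum>k<n. q k 0) * wahba_score n d \<sigma> R \<xi> X)) (at 0)"
    unfolding wahba_score_def by (intro DERIV_cmult DERIV_chain2[OF DERIV_exp] DERIV_sum dq) auto
  then show ?thesis
    using eq[of 0] by (simp add: eq mult.assoc)
qed

subsection \<open>Expansion of the differential\<close>

lemma bounded_bilinear_outer: "bounded_bilinear (outer :: real^'n \<Rightarrow> real^'m \<Rightarrow> real^'m^'n)"
  by (rule bilinear_conv_bounded_bilinear[THEN iffD1])
    (auto simp: bilinear_def linear_iff outer_def vec_eq_iff algebra_simps)

lemma inner_outer: "v \<bullet> (outer x y *v w) = (v \<bullet> x) * (y \<bullet> w)"
proof -
  have "outer x y *v w = (y \<bullet> w) *\<^sub>R x"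
    by (simp add: outer_def matrix_vector_mult_def inner_vec_def vec_eq_iff sum_distrib_left mult_ac)
  then show ?thesis by simp
qed

lemma trace_outer: "trace (outer x x) = x \<bullet> x"
  by (simp add: outer_def trace_def inner_vec_def)

lemma bounded_bilinear_skew3_mult: "bounded_bilinear (\<lambda>x y. skew3 x ** skew3 y)"
  by (intro bounded_bilinear.comp[OF bounded_bilinear_matrix_mult] bounded_linear_skew3)

lemma bounded_linear_quadratic_form: "bounded_linear (\<lambda>A::real^'n^'m. v \<bullet> (A *v w))"
  by (rule linear_conv_bounded_linear[THEN iffD1])
    (auto simp: linear_iff matrix_vector_mult_add_rdistrib scaleR_matrix_vector_assoc[symmetric] inner_add_right)

lemma bounded_linear_transpose: "bounded_linear (transpose :: real^'n^'m \<Rightarrow> real^'m^'n)"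
  by (rule linear_conv_bounded_linear[THEN iffD1])
    (auto simp: linear_iff transpose_def vec_eq_iff)

lemma borel_measurable_cross3 [measurable (raw)]:
  assumes [measurable]: "f \<in> borel_measurable M" "g \<in> borel_measurable M"
  shows "(\<lambda>x. f x \<times> g x) \<in> borel_measurable M"
  by (rule borel_measurable_continuous_Pair[OF assms])
    (intro continuous_on_cross continuous_intros)

lemma log_diff_borel [measurable]: "(\<lambda>x. log_diff x \<xi>) \<in> borel_measurable borel"
proof -
  have [measurable]: "sin \<in> borel_measurable (borel :: real measure)" "cos \<in> borel_measurable (borel :: real measure)"
    by (intro borel_measurable_continuous_onI continuous_intros)+
  show ?thesis unfolding log_diff_def by measurable
qed

text \<open>What \<open>log_diff\<close> contains beyond its quadratic Taylor polynomial in
  \<open>x\<close>, kept as a matrix free of \<open>\<xi>\<close> so that a single expectation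
  serves all directions.\<close>

definition log_diff_rem :: "real^3 \<Rightarrow> real^3^3" where
  "log_diff_rem x =
     (1 / (norm x)\<^sup>2 - (1 + cos (norm x)) / (2 * norm x * sin (norm x)) - 1 / 12) *\<^sub>R (skew3 x ** skew3 x)"

lemma log_diff_rem_borel [measurable]: "log_diff_rem \<in> borel_measurable borel"
proof -
  have [measurable]: "sin \<in> borel_measurable (borel :: real measure)" "cos \<in> borel_measurable (borel :: real measure)"
    by (intro borel_measurable_continuous_onI continuous_intros)+
  have [measurable]: "(\<lambda>x. skew3 x ** skew3 x) \<in> borel_measurable borel"
    by (intro borel_measurable_continuous_onI bounded_bilinear.continuous_on[OF bounded_bilinear_skew3_mult] continuous_on_id)
  show ?thesis unfolding log_diff_rem_def[abs_def] by measurable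
qed

text \<open>Arranged for taking expectations: the term linear in \<open>x\<close> vanishes by
  unbiasedness, and the quadratic ones produce the covariance and its trace.\<close>

lemma inner_log_diff:
  "v \<bullet> log_diff x \<xi> = v \<bullet> \<xi> + (1/2) * ((v \<times> \<xi>) \<bullet> x)
     + (1/12) * ((v \<bullet> x) * (x \<bullet> \<xi>) - (x \<bullet> x) * (v \<bullet> \<xi>)) + v \<bullet> (log_diff_rem x *v \<xi>)"
proof -
  have tri: "v \<bullet> (\<xi> \<times> x) = (v \<times> \<xi>) \<bullet> x"
    by (simp add: cross3_simps)
  show ?thesis
    unfolding log_diff_def log_diff_rem_def inner_add_right inner_scaleR_right tri
      scaleR_matrix_vector_assoc[symmetric] matrix_vector_mul_assoc[symmetric] skew3_mult_vec
    by (simp add: Lagrange inner_diff_right algebra_simps)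
qed

lemma log_diff_rem_bound: "\<exists>K\<ge>0. \<forall>x. norm x < pi \<longrightarrow> norm (log_diff_rem x) \<le> K * norm x ^ 3"
proof -
  obtain K where K: "0 \<le> K" "\<And>x y. norm (skew3 x ** skew3 y) \<le> norm x * norm y * K"
    using bounded_bilinear.nonneg_bounded[OF bounded_bilinear_skew3_mult] by auto
  have "norm (log_diff_rem x) \<le> K / 2 * norm x ^ 3" if "norm x < pi" for x
  proof (cases "x = 0")
    case False
    have "norm (log_diff_rem x) \<le> (norm x / 2) * (norm x * norm x * K)"
      unfolding log_diff_rem_def norm_scaleR
      by (intro mult_mono log_diff_coeff_bound K) (use False that in auto)
    then show ?thesis by (simp add: power3_eq_cube mult_ac)
  qed (simp add: log_diff_rem_def)
  then show ?thesis using K(1) by (intro exI[of _ "K/2"]) auto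
qed

subsection \<open>The Cramer-Rao inequality\<close>

lemma prob_space_wahba_law:
  assumes "\<And>k. k < n \<Longrightarrow> 0 < \<sigma> k"
  shows "prob_space (wahba_law n d \<sigma> R)"
proof -
  define s where "s k = (if k < n then \<sigma> k else 1)" for k
  define N where "N k = density lborel (\<lambda>v::real^3. ennreal (gauss3_density 0 (s k) v))" for k
  interpret N: product_prob_space N "{..<n}"
    by (intro product_prob_spaceI) (simp add: N_def prob_space_gauss3 s_def assms)
  have noise: "noise_law n \<sigma> = Pi\<^sub>M {..<n} N"
    unfolding noise_law_def N_def by (intro PiM_cong) (auto simp: s_def)
  have setsN: "sets (Pi\<^sub>M {..<n} N) = sets (\<Pi>\<^sub>M k\<in>{..<n}. borel)"
    by (intro sets_PiM_cong) (auto simp: N_def)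
  have "(\<lambda>V. \<lambda>k\<in>{..<n}. transpose R *v d k + V k) \<in> measurable (Pi\<^sub>M {..<n} N) (\<Pi>\<^sub>M k\<in>{..<n}. borel)"
    by (subst measurable_cong_sets[OF setsN refl]) measurable
  then show ?thesis
    unfolding wahba_law_def noise by (rule N.P.prob_space_distr)
qed

lemma sets_wahba_law: "sets (wahba_law n d \<sigma> R) = sets (\<Pi>\<^sub>M k\<in>{..<n}. borel)"
  by (simp add: wahba_law_def)

lemma log_error_measurable:
  assumes "SO3_estimator n Rh"
  shows "log_error Rh R \<in> borel_measurable (\<Pi>\<^sub>M k\<in>{..<n}. borel)"
proof -
  have [measurable]: "Rh \<in> borel_measurable (\<Pi>\<^sub>M k\<in>{..<n}. borel)"
    using assms by (simp add: SO3_estimator_def)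
  have [measurable]: "(\<lambda>A. R ** transpose A) \<in> borel_measurable borel"
    by (intro borel_measurable_continuous_onI bounded_bilinear.continuous_on[OF bounded_bilinear_matrix_mult]
        linear_continuous_on bounded_linear_transpose continuous_on_const)
  show ?thesis unfolding log_error_def[abs_def] by measurable
qed

text \<open>The density is everywhere positive, so the laws for all parameters share the null sets
  of Lebesgue measure. Almost sure facts at different parameters can then be combined.\<close>

lemma AE_wahba_law_iff:
  assumes "\<And>k. k < n \<Longrightarrow> 0 < \<sigma> k"
  shows "(AE X in wahba_law n d \<sigma> R. Q X) \<longleftrightarrow> (AE X in (\<Pi>\<^sub>M k\<in>{..<n}. lborel). Q X)"
proof -
  have [measurable]: "(\<lambda>X. wahba_density n d \<sigma> R X) \<in> borel_measurable (\<Pi>\<^sub>M k\<in>{..<n}. lborel)"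
    unfolding wahba_density_def by measurable
  have "0 < wahba_density n d \<sigma> R X" for X
    by (rule wahba_density_pos[OF assms])
  moreover have "wahba_law n d \<sigma> R = density (\<Pi>\<^sub>M k\<in>{..<n}. lborel) (\<lambda>X. ennreal (wahba_density n d \<sigma> R X))"
    by (rule wahba_law_eq_density[OF assms])
  ultimately show ?thesis
    by (simp only:) (subst AE_density, auto)
qed

text \<open>The integral of density times error is 0 for all small \<open>t\<close>, so its
  derivative is 0 too. Under the integral the product rule gives the density times score times error
  plus \<open>log_diff\<close>, and the density is absorbed into the law.\<close>

lemma unbiased_derivative_identity:
  assumes \<sigma>: "\<And>k. k < n \<Longrightarrow> 0 < \<sigma> k"
    and est: "SO3_estimator n Rh"
    and unb: "\<forall>\<^sub>F t in nhds (0::real). unbiased_at n d \<sigma> Rh (so3_exp (t *\<^sub>R \<xi>) ** R)"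
    and reg: "wahba_regular_at n d \<sigma> Rh R"
  shows "has_bochner_integral (wahba_law n d \<sigma> R)
    (\<lambda>X. wahba_score n d \<sigma> R \<xi> X *\<^sub>R log_error Rh R X + log_diff (log_error Rh R X) \<xi>) 0"
proof -
  define L where "L = (\<Pi>\<^sub>M k\<in>{..<n}. (lborel :: (real^3) measure))"
  define G where "G t = so3_exp (t *\<^sub>R \<xi>) ** R" for t
  define p where "p t X = wahba_density n d \<sigma> (G t) X" for t X
  define e where "e t X = log_error Rh (G t) X" for t X
  define s where "s X = wahba_score n d \<sigma> R \<xi> X" for X
  have G0: "G 0 = R" by (simp add: G_def)
  have setsL: "sets L = sets (\<Pi>\<^sub>M k\<in>{..<n}. borel)"
    unfolding L_def by (intro sets_PiM_cong) auto
  have eL[measurable]: "e t \<in> borel_measurable L" for t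
    using log_error_measurable[OF est] by (subst measurable_cong_sets[OF setsL refl]) (simp add: e_def[abs_def])
  have pL[measurable]: "p t \<in> borel_measurable L" for t
    unfolding p_def[abs_def] wahba_density_def L_def by measurable
  have sL[measurable]: "s \<in> borel_measurable L"
    unfolding s_def[abs_def] wahba_score_def L_def by measurable
  have ppos: "0 < p t X" for t X unfolding p_def by (rule wahba_density_pos[OF \<sigma>])
  have law: "wahba_law n d \<sigma> (G t) = density L (\<lambda>X. ennreal (p t X))" for t
    unfolding p_def L_def by (rule wahba_law_eq_density[OF \<sigma>])
  have diff: "diff_under_integral_at L (\<lambda>t X. p t X *\<^sub>R e t X) 0"
    using reg by (simp add: wahba_regular_at_def L_def p_def e_def G_def)
  let ?V = "\<lambda>X. vector_derivative (\<lambda>t. p t X *\<^sub>R e t X) (at 0)"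
  have "(\<integral>X. p t X *\<^sub>R e t X \<partial>L) = (\<integral>X. e t X \<partial>wahba_law n d \<sigma> (G t))" for t
    unfolding law by (subst integral_density) (use ppos in \<open>auto simp: less_imp_le\<close>)
  with unb have ev0: "\<forall>\<^sub>F t in nhds 0. (\<integral>X. p t X *\<^sub>R e t X \<partial>L) = 0"
    unfolding G_def[symmetric] by (auto simp: unbiased_at_def e_def elim: eventually_mono)
  have "((\<lambda>t. \<integral>X. p t X *\<^sub>R e t X \<partial>L) has_vector_derivative (\<integral>X. ?V X \<partial>L)) (at 0)"
    using diff by (simp add: diff_under_integral_at_def)
  then have "((\<lambda>t::real. 0) has_vector_derivative (\<integral>X. ?V X \<partial>L)) (at 0)"
    using has_vector_derivative_cong_ev[where f = "\<lambda>t. \<integral>X. p t X *\<^sub>R e t X \<partial>L" and g = "\<lambda>t. 0" and x = 0 and S = UNIV]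
      ev0 eventually_nhds_x_imp_x[OF ev0] by (auto elim: eventually_mono)
  then have int0: "(\<integral>X. ?V X \<partial>L) = 0"
    using vector_derivative_unique_at has_vector_derivative_const by blast
  obtain \<delta> where \<delta>: "\<delta> > 0" "\<And>t. \<bar>t\<bar> < \<delta> \<Longrightarrow> unbiased_at n d \<sigma> Rh (G t)"
    using unb unfolding G_def[symmetric] eventually_nhds_metric by (auto simp: dist_real_def)
  have dom: "AE X in L. G t ** transpose (Rh X) \<in> so3_log_dom" if "\<bar>t\<bar> < \<delta>" for t
    using \<delta>(2)[OF that] AE_wahba_law_iff[where n = n and \<sigma> = \<sigma>, OF \<sigma>] unfolding L_def unbiased_at_def by blast
  \<comment> \<open>A sequence tending to 0 without reaching it; the shift by 2 keeps every term
    strictly inside the range where unbiasedness holds. Countably many exceptional null sets have a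
    null union.\<close>
  define u where "u m = \<delta> / (real m + 2)" for m
  have u: "u m \<noteq> 0" "\<bar>u m\<bar> < \<delta>" for m
    using \<delta>(1) by (auto simp: u_def field_simps intro: add_pos_nonneg)
  have u0: "u \<longlonglongrightarrow> 0"
    unfolding u_def[abs_def] by real_asymp
  have "AE X in L. \<forall>m. G (u m) ** transpose (Rh X) \<in> so3_log_dom"
    using dom u by (simp add: AE_all_countable)
  moreover have "AE X in L. R ** transpose (Rh X) \<in> so3_log_dom"
    using dom[of 0] \<delta>(1) by (simp add: G0)
  moreover have "AE X in L. (\<lambda>t. p t X *\<^sub>R e t X) differentiable at 0"
    using diff by (simp add: diff_under_integral_at_def)
  ultimately have AE: "AE X in L. ?V X = p 0 X *\<^sub>R (s X *\<^sub>R e 0 X + log_diff (e 0 X) \<xi>)"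
  proof eventually_elim
    case (elim X)
    define Q where "Q = R ** transpose (Rh X)"
    have GQ: "G t ** transpose (Rh X) = so3_exp (t *\<^sub>R \<xi>) ** Q" for t
      by (simp add: G_def Q_def matrix_mul_assoc)
    have e: "e t X = so3_log (so3_exp (t *\<^sub>R \<xi>) ** Q)" for t
      by (simp add: e_def log_error_def GQ)
    have e0: "e 0 X = so3_log Q" by (simp add: e)
    have dp: "((\<lambda>t. p t X) has_real_derivative p 0 X * s X) (at 0)"
      using wahba_density_deriv[OF \<sigma>, where R = R] by (simp add: p_def G_def s_def)
    \<comment> \<open>Regularity gives differentiability only of density times error. Dividing by
      the positive differentiable density transfers it to the error itself.\<close>
    then have "(\<lambda>t. inverse (p t X)) differentiable at 0"
      using ppos[of 0 X] DERIV_inverse'[OF dp] by (auto simp: real_differentiable_def)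
    then have "(\<lambda>t. inverse (p t X) *\<^sub>R (p t X *\<^sub>R e t X)) differentiable at 0"
      by (intro differentiable_scaleR elim(3))
    moreover have "inverse (p t X) *\<^sub>R (p t X *\<^sub>R e t X) = e t X" for t
      using ppos[of t X] by simp
    ultimately have "(\<lambda>t. e t X) differentiable at 0" by simp
    then have "((\<lambda>t. e t X) has_vector_derivative log_diff (e 0 X) \<xi>) (at 0)"
      unfolding e0 unfolding e by (intro so3_log_line_deriv[OF _ _ u0]) (use elim u in \<open>auto simp: GQ Q_def[symmetric]\<close>)
    from has_vector_derivative_scaleR[OF dp this] show ?case
      by (intro vector_derivative_at) (simp add: algebra_simps)
  qed
  have intV: "integrable L ?V"
    using diff by (simp add: diff_under_integral_at_def)
  have "has_bochner_integral L ?V 0"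
    using intV int0 by (simp add: has_bochner_integral_iff)
  moreover have "?V \<in> borel_measurable L" using intV by simp
  moreover have [measurable]: "(\<lambda>X. s X *\<^sub>R e 0 X + log_diff (e 0 X) \<xi>) \<in> borel_measurable L"
    by measurable
  ultimately have "has_bochner_integral L (\<lambda>X. p 0 X *\<^sub>R (s X *\<^sub>R e 0 X + log_diff (e 0 X) \<xi>)) 0"
    using AE by (subst (asm) has_bochner_integral_cong_AE) auto
  then have "has_bochner_integral (density L (\<lambda>X. ennreal (p 0 X))) (\<lambda>X. s X *\<^sub>R e 0 X + log_diff (e 0 X) \<xi>) 0"
    using ppos by (intro has_bochner_integral_density) (auto simp: less_imp_le)
  then show ?thesis
    unfolding law[symmetric] G0 e_def s_def .
qed

lemma matrix_mult_matrix_inv: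
  fixes A :: "'a::semiring_1^'n^'m"
  assumes "invertible A"
  shows "A ** matrix_inv A = mat 1"
  using someI_ex[of "\<lambda>B. A ** B = mat 1 \<and> B ** A = mat 1"] assms
  unfolding matrix_inv_def invertible_def by blast

lemma norm_transpose_real: "norm (transpose A) = norm (A :: real^'n^'m)"
  unfolding norm_vec_def L2_set_def
  by (simp add: transpose_def real_sqrt_pow2 sum_nonneg) (rule sum.swap)

theorem proposition2:
  shows "\<exists>c :: real^3^3 \<Rightarrow> real.
    \<forall>(n::nat) (d :: nat \<Rightarrow> real^3) (\<sigma> :: nat \<Rightarrow> real) (R :: real^3^3)
      (Rh :: (nat \<Rightarrow> real^3) \<Rightarrow> real^3^3).
      (\<forall>k<n. 0 < \<sigma> k) \<longrightarrow>
      rotation_matrix R \<longrightarrow>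
      invertible (wahba_info n d \<sigma>) \<longrightarrow>
      SO3_estimator n Rh \<longrightarrow>
      (\<forall>\<xi>. \<forall>\<^sub>F t in nhds (0::real). unbiased_at n d \<sigma> Rh (so3_exp (t *\<^sub>R \<xi>) ** R)) \<longrightarrow>
      wahba_regular_at n d \<sigma> Rh R \<longrightarrow>
      (let P = error_covariance n d \<sigma> Rh R;
           Jinv = matrix_inv (wahba_info n d \<sigma>);
           M = trace P *\<^sub>R mat 1 - P
       in \<exists>E :: real^3^3.
            transpose E = E \<and>
            norm E \<le> c Jinv * (\<integral>X. norm (log_error Rh R X) ^ 3 \<partial>wahba_law n d \<sigma> R) \<and>
            loewner_le
              (Jinv - (1/12) *\<^sub>R (M ** Jinv) - (1/12) *\<^sub>R (Jinv ** M) + E) P)"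
proof -
  obtain K where K: "0 \<le> K" "\<And>x. norm x < pi \<Longrightarrow> norm (log_diff_rem x) \<le> K * norm x ^ 3"
    using log_diff_rem_bound by auto
  obtain K2 where K2: "0 \<le> K2" "\<And>(A :: real^3^3) (B :: real^3^3). norm (A ** B) \<le> norm A * norm B * K2"
    using bounded_bilinear.nonneg_bounded[OF bounded_bilinear_matrix_mult[where 'm = 3 and 'n = 3 and 'p = 3]] by blast
  obtain K3 where K3: "0 \<le> K3" "\<And>(x :: real^3) (y :: real^3). norm (outer x y) \<le> norm x * norm y * K3"
    using bounded_bilinear.nonneg_bounded[OF bounded_bilinear_outer[where 'm = 3 and 'n = 3]] by blast
  \<comment> \<open>The 2 comes from symmetrising the error matrix, \<open>K\<close> from the cubic
    remainder and \<open>K2\<close> from the norm of a matrix product. \<open>K\<close> and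
    \<open>K2\<close> are fixed before any data of the model.\<close>
  define c where "c J = 2 * K * K2 * norm J" for J :: "real^3^3"
  show ?thesis
  proof (rule exI[of _ c], intro allI impI)
    fix n d \<sigma> R Rh
    assume \<sigma>: "\<forall>k<n. 0 < \<sigma> k" and R: "rotation_matrix R" and inv: "invertible (wahba_info n d \<sigma>)"
      and est: "SO3_estimator n Rh"
      and unb: "\<forall>\<xi>. \<forall>\<^sub>F t in nhds (0::real). unbiased_at n d \<sigma> Rh (so3_exp (t *\<^sub>R \<xi>) ** R)"
      and reg: "wahba_regular_at n d \<sigma> Rh R"
    define J where "J = wahba_info n d \<sigma>"
    define Ji where "Ji = matrix_inv J"
    define \<mu> where "\<mu> = wahba_law n d \<sigma> R"
    define e where "e = log_error Rh R"
    define s where "s = wahba_score n d \<sigma> R"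
    define P where "P = error_covariance n d \<sigma> Rh R"
    define M where "M = trace P *\<^sub>R mat 1 - P"
    interpret prob_space \<mu>
      unfolding \<mu>_def by (rule prob_space_wahba_law) (use \<sigma> in auto)
    have e_meas[measurable]: "e \<in> borel_measurable \<mu>"
      unfolding e_def \<mu>_def using log_error_measurable[OF est]
      by (subst measurable_cong_sets[OF sets_wahba_law refl])
    have s_meas[measurable]: "s \<xi> \<in> borel_measurable \<mu>" for \<xi>
    proof -
      have "s \<xi> \<in> borel_measurable (\<Pi>\<^sub>M k\<in>{..<n}. borel)"
        unfolding s_def wahba_score_def[abs_def] by measurable
      then show ?thesis
        unfolding \<mu>_def by (subst measurable_cong_sets[OF sets_wahba_law refl])
    qed
    have "unbiased_at n d \<sigma> Rh R"
      using eventually_nhds_x_imp_x[OF unb[rule_format, of 0]] by simp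
    then have dom: "AE X in \<mu>. R ** transpose (Rh X) \<in> so3_log_dom" and e0: "(\<integral>X. e X \<partial>\<mu>) = 0"
      unfolding unbiased_at_def \<mu>_def e_def by blast+
    \<comment> \<open>The logarithm takes values in a bounded ball, so on a probability space every
      moment of the error is finite without further assumptions.\<close>
    from dom have epi: "AE X in \<mu>. norm (e X) < pi"
      by eventually_elim (simp add: e_def log_error_def so3_log_domE(1))
    have pow: "AE X in \<mu>. norm (e X) ^ m \<le> pi ^ m" for m
      using epi by eventually_elim (simp add: power_mono)
    have int_e: "integrable \<mu> e"
      by (rule integrable_const_bound[of _ pi]) (use epi in \<open>auto elim: eventually_mono\<close>)
    have int_e3: "integrable \<mu> (\<lambda>X. norm (e X) ^ 3)"
      by (rule integrable_const_bound[of _ "pi ^ 3"]) (use pow[of 3] in auto)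
    define H where "H X = log_diff_rem (e X)" for X
    have [measurable]: "H \<in> borel_measurable \<mu>" unfolding H_def[abs_def] by measurable
    have H_le: "AE X in \<mu>. norm (H X) \<le> K * norm (e X) ^ 3"
      using epi by eventually_elim (simp add: H_def K)
    have int_H: "integrable \<mu> H"
      by (rule Bochner_Integration.integrable_bound[OF integrable_mult_right[OF int_e3, of K]])
        (use H_le in \<open>auto elim!: eventually_mono\<close>)
    define B where "B = (\<integral>X. H X \<partial>\<mu>)"
    have norm_B: "norm B \<le> K * (\<integral>X. norm (e X) ^ 3 \<partial>\<mu>)"
    proof -
      have "norm B \<le> (\<integral>X. norm (H X) \<partial>\<mu>)" unfolding B_def by (rule integral_norm_bound)
      also have "\<dots> \<le> (\<integral>X. K * norm (e X) ^ 3 \<partial>\<mu>)"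
        by (rule integral_mono_AE) (use int_H int_e3 H_le in auto)
      finally show ?thesis by simp
    qed
    have int_outer: "integrable \<mu> (\<lambda>X. outer (e X) (e X))"
    proof (rule integrable_const_bound[of _ "pi\<^sup>2 * K3"])
      show "AE X in \<mu>. norm (outer (e X) (e X)) \<le> pi\<^sup>2 * K3"
        using pow[of 2]
      proof eventually_elim
        case (elim X)
        then have "norm (e X) * norm (e X) * K3 \<le> pi\<^sup>2 * K3"
          using K3(1) by (intro mult_right_mono) (auto simp: power2_eq_square)
        then show ?case using K3(2)[of "e X" "e X"] by linarith
      qed
      have [measurable]: "(\<lambda>x::real^3. outer x x) \<in> borel_measurable borel"
        by (intro borel_measurable_continuous_onI bounded_bilinear.continuous_on[OF bounded_bilinear_outer] continuous_on_id)
      show "(\<lambda>X. outer (e X) (e X)) \<in> borel_measurable \<mu>" by measurable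
    qed
    have P_eq: "P = (\<integral>X. outer (e X) (e X) \<partial>\<mu>)"
      by (simp add: P_def error_covariance_def e_def \<mu>_def)
    have P_form: "has_bochner_integral \<mu> (\<lambda>X. (v \<bullet> e X) * (e X \<bullet> w)) (v \<bullet> (P *v w))" for v w
      unfolding P_eq inner_outer[symmetric]
      by (rule has_bochner_integral_bounded_linear[OF bounded_linear_quadratic_form])
        (simp add: has_bochner_integral_iff int_outer)
    have P_tr: "has_bochner_integral \<mu> (\<lambda>X. e X \<bullet> e X) (trace P)"
      unfolding P_eq trace_outer[symmetric]
      by (rule has_bochner_integral_bounded_linear[OF bounded_linear_trace])
        (simp add: has_bochner_integral_iff int_outer)
    have B_form: "has_bochner_integral \<mu> (\<lambda>X. v \<bullet> (H X *v w)) (v \<bullet> (B *v w))" for v w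
      unfolding B_def
      by (rule has_bochner_integral_bounded_linear[OF bounded_linear_quadratic_form])
        (simp add: has_bochner_integral_iff int_H)
    have e_form: "has_bochner_integral \<mu> (\<lambda>X. v \<bullet> e X) 0" for v
      using has_bochner_integral_bounded_linear[OF bounded_linear_inner_right, of \<mu> e 0 v] int_e e0
      by (simp add: has_bochner_integral_iff)
    have M_form: "v \<bullet> (M *v w) = trace P * (v \<bullet> w) - v \<bullet> (P *v w)" for v w
      by (simp add: M_def matrix_vector_mult_diff_rdistrib scaleR_matrix_vector_assoc[symmetric] inner_diff_right)
    have se: "has_bochner_integral \<mu> (\<lambda>X. s w X * (v \<bullet> e X)) (- (v \<bullet> w - (1/12) * (v \<bullet> (M *v w)) + v \<bullet> (B *v w)))" for v w
    proof -
      \<comment> \<open>The summand \<open>(1/2) * 0\<close> is the expectation of the linear term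
        of \<open>inner_log_diff\<close>, zero because \<open>e\<close> has mean zero.\<close>
      have ld: "has_bochner_integral \<mu> (\<lambda>X. v \<bullet> log_diff (e X) w)
         (v \<bullet> w + (1/2) * 0 + (1/12) * (v \<bullet> (P *v w) - trace P * (v \<bullet> w)) + v \<bullet> (B *v w))"
        unfolding inner_log_diff H_def[symmetric]
        by (intro has_bochner_integral_add has_bochner_integral_diff has_bochner_integral_mult_right
            has_bochner_integral_mult_left e_form P_form P_tr B_form)
          (simp add: has_bochner_integral_iff prob_space)
      have "has_bochner_integral \<mu> (\<lambda>X. s w X *\<^sub>R e X + log_diff (e X) w) 0"
        unfolding \<mu>_def s_def e_def
        by (rule unbiased_derivative_identity) (use \<sigma> est unb reg in auto)
      from has_bochner_integral_diff[OF has_bochner_integral_bounded_linear[OF bounded_linear_inner_right this, of v] ld]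
      show ?thesis by (simp add: inner_add_right M_form algebra_simps)
    qed
    have ss: "has_bochner_integral \<mu> (\<lambda>X. (s w X)\<^sup>2) (w \<bullet> (J *v w))" for w
      unfolding \<mu>_def s_def J_def by (rule wahba_score_second_moment) (use \<sigma> R in auto)
    \<comment> \<open>\<open>w\<close> will be \<open>Ji *v v\<close>, the choice that makes the bound linear in \<open>M\<close> and \<open>B\<close>.\<close>
    have CS: "0 \<le> v \<bullet> (P *v v) - 2 * (v \<bullet> w - (1/12) * (v \<bullet> (M *v w)) + v \<bullet> (B *v w)) + w \<bullet> (J *v w)" for v w
    proof -
      have "has_bochner_integral \<mu> (\<lambda>X. (v \<bullet> e X) * (e X \<bullet> v) + 2 * (s w X * (v \<bullet> e X)) + (s w X)\<^sup>2)
        (v \<bullet> (P *v v) + 2 * (- (v \<bullet> w - (1/12) * (v \<bullet> (M *v w)) + v \<bullet> (B *v w))) + w \<bullet> (J *v w))"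
        by (intro has_bochner_integral_add has_bochner_integral_mult_right P_form se ss)
      moreover have "(v \<bullet> e X) * (e X \<bullet> v) + 2 * (s w X * (v \<bullet> e X)) + (s w X)\<^sup>2 = (v \<bullet> e X + s w X)\<^sup>2" for X
        by (simp add: power2_eq_square inner_commute algebra_simps)
      ultimately have "has_bochner_integral \<mu> (\<lambda>X. (v \<bullet> e X + s w X)\<^sup>2)
        (v \<bullet> (P *v v) + 2 * (- (v \<bullet> w - (1/12) * (v \<bullet> (M *v w)) + v \<bullet> (B *v w))) + w \<bullet> (J *v w))"
        by simp
      then have "(\<integral>X. (v \<bullet> e X + s w X)\<^sup>2 \<partial>\<mu>) =
        v \<bullet> (P *v v) + 2 * (- (v \<bullet> w - (1/12) * (v \<bullet> (M *v w)) + v \<bullet> (B *v w))) + w \<bullet> (J *v w)"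
        by (rule has_bochner_integral_integral_eq)
      moreover have "0 \<le> (\<integral>X. (v \<bullet> e X + s w X)\<^sup>2 \<partial>\<mu>)" by simp
      ultimately show ?thesis by linarith
    qed
    have J_sym: "transpose J = J"
    proof -
      have "u \<bullet> (transpose J *v w) = u \<bullet> (J *v w)" for u w
      proof -
        have "u \<bullet> (transpose J *v w) = w \<bullet> (J *v u)"
          by (simp add: inner_commute[of u] dot_lmul_matrix)
        also have "\<dots> = u \<bullet> (J *v w)"
          unfolding J_def inner_wahba_info by (intro sum.cong refl) (simp only: inner_commute)
        finally show ?thesis .
      qed
      then have "transpose J *v w = J *v w" for w
        using vector_eq_ldot by blast
      then show ?thesis unfolding matrix_eq by blast
    qed
    have JJi: "J ** Ji = mat 1"
      using inv unfolding J_def Ji_def by (rule matrix_mult_matrix_inv)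
    have Ji_sym: "transpose Ji = Ji"
    proof -
      have "transpose Ji ** J = mat 1"
        using arg_cong[OF JJi, of transpose] by (simp add: matrix_transpose_mul J_sym)
      then have "transpose Ji ** (J ** Ji) = Ji" by (simp add: matrix_mul_assoc)
      then show ?thesis by (simp add: JJi)
    qed
    have P_sym: "transpose P = P"
      unfolding P_eq
      by (subst integral_bounded_linear[OF bounded_linear_transpose int_outer, symmetric])
        (simp add: outer_def transpose_def mult.commute)
    have M_sym: "transpose M = M"
      unfolding M_def
      using bounded_linear.linear[OF bounded_linear_transpose[where 'n = 3 and 'm = 3]]
      by (simp add: linear_diff linear_scale P_sym transpose_mat)
    \<comment> \<open>The Loewner order needs a symmetric matrix, and \<open>B ** Ji\<close> need
      not be one. Adding its transpose doubles its quadratic form, which matches the factor 2 of the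
      cross term in \<open>CS\<close>.\<close>
    define E where "E = B ** Ji + transpose (B ** Ji)"
    have t_add: "transpose (A + C) = transpose A + transpose C"
      and t_diff: "transpose (A - C) = transpose A - transpose C"
      and t_scale: "transpose (r *\<^sub>R A) = r *\<^sub>R transpose A" for A C :: "real^3^3" and r
      using bounded_linear.linear[OF bounded_linear_transpose[where 'n = 3 and 'm = 3]]
      by (simp_all add: linear_diff linear_scale linear_add)
    have E_sym: "transpose E = E" by (simp add: E_def t_add add.commute)
    have "norm E \<le> norm (B ** Ji) + norm (B ** Ji)"
      unfolding E_def by (rule order_trans[OF norm_triangle_ineq]) (simp add: norm_transpose_real)
    also have "\<dots> \<le> 2 * (norm B * norm Ji * K2)"
      using K2(2)[of B Ji] by simp
    also have "\<dots> \<le> 2 * ((K * (\<integral>X. norm (e X) ^ 3 \<partial>\<mu>)) * norm Ji * K2)"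
      by (intro mult_left_mono mult_right_mono norm_B K2) auto
    also have "\<dots> = c Ji * (\<integral>X. norm (e X) ^ 3 \<partial>\<mu>)"
      by (simp add: c_def)
    finally have E_norm: "norm E \<le> c Ji * (\<integral>X. norm (e X) ^ 3 \<partial>\<mu>)" .
    have "loewner_le (Ji - (1/12) *\<^sub>R (M ** Ji) - (1/12) *\<^sub>R (Ji ** M) + E) P"
      unfolding loewner_le_def
    proof (intro conjI allI)
      show "transpose (P - (Ji - (1/12) *\<^sub>R (M ** Ji) - (1/12) *\<^sub>R (Ji ** M) + E)) =
          P - (Ji - (1/12) *\<^sub>R (M ** Ji) - (1/12) *\<^sub>R (Ji ** M) + E)"
        by (simp add: t_add t_diff t_scale matrix_transpose_mul P_sym Ji_sym M_sym E_sym algebra_simps)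
      fix v
      define w where "w = Ji *v v"
      have tr: "v \<bullet> (transpose A *v v) = v \<bullet> (A *v v)" for A :: "real^3^3"
        by (simp add: inner_commute[of v] dot_lmul_matrix)
      have Jw: "J *v w = v" by (simp add: w_def matrix_vector_mul_assoc JJi)
      have MJ: "v \<bullet> ((M ** Ji) *v v) = v \<bullet> (M *v w)" and BJ: "v \<bullet> ((B ** Ji) *v v) = v \<bullet> (B *v w)"
        by (simp_all add: w_def matrix_vector_mul_assoc)
      \<comment> \<open>\<open>Ji ** M\<close> is the transpose of \<open>M ** Ji\<close>, so both
        have the same quadratic form and the two corrections by 1/12 add up to 1/6.\<close>
      have JM: "v \<bullet> ((Ji ** M) *v v) = v \<bullet> (M *v w)"
        using tr[of "M ** Ji"] MJ by (simp add: matrix_transpose_mul Ji_sym M_sym)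
      have EE: "v \<bullet> (E *v v) = 2 * (v \<bullet> (B *v w))"
        unfolding E_def using tr[of "B ** Ji"] BJ
        by (simp add: matrix_vector_mult_add_rdistrib inner_add_right)
      have "v \<bullet> ((P - (Ji - (1/12) *\<^sub>R (M ** Ji) - (1/12) *\<^sub>R (Ji ** M) + E)) *v v)
        = v \<bullet> (P *v v) - (v \<bullet> w - (1/6) * (v \<bullet> (M *v w)) + 2 * (v \<bullet> (B *v w)))"
        unfolding matrix_vector_mult_diff_rdistrib matrix_vector_mult_add_rdistrib inner_add_right
          inner_diff_right scaleR_matrix_vector_assoc[symmetric] inner_scaleR_right MJ JM EE w_def[symmetric]
        by simp
      also have "0 \<le> \<dots>"
        \<comment> \<open>Since \<open>J *v w = v\<close>, the variance of the score is
          \<open>w \<bullet> v\<close>; it cancels one of the two copies of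
          \<open>v \<bullet> w\<close> in \<open>CS\<close>.\<close>
        using CS[of v w] by (simp add: Jw inner_commute[of w v])
      finally show "0 \<le> v \<bullet> ((P - (Ji - (1/12) *\<^sub>R (M ** Ji) - (1/12) *\<^sub>R (Ji ** M) + E)) *v v)" .
    qed
    with E_sym E_norm show "let P = error_covariance n d \<sigma> Rh R;
           Jinv = matrix_inv (wahba_info n d \<sigma>);
           M = trace P *\<^sub>R mat 1 - P
       in \<exists>E :: real^3^3.
            transpose E = E \<and>
            norm E \<le> c Jinv * (\<integral>X. norm (log_error Rh R X) ^ 3 \<partial>wahba_law n d \<sigma> R) \<and>
            loewner_le
              (Jinv - (1/12) *\<^sub>R (M ** Jinv) - (1/12) *\<^sub>R (Jinv ** M) + E) P"
      unfolding Let_def P_def[symmetric] J_def[symmetric] Ji_def[symmetric] M_def[symmetric] e_def \<mu>_def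
      by blast
  qed
qed

end
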